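(* Let $b>1$ be an integer and $w$ a non-empty word over $\{0,\dots,b-1\}$, with associated point $x_w$, $R_w=\max(x_w,1-x_w)$, and monic eigenpolynomials $(\mathcal B_m)_{m\ge0}$. For any $R>R_w$, the normalized eigenpolynomials $(R^{-m}\mathcal B_m)_{m\ge0}$ are exponentially close in $\mathcal H_R$-norm, as $m\to\infty$, to the normalized monomials $e_m(z)=(z-x_w)^m/R^m$ giving the canonical orthonormal basis of $\mathcal H_R$ (i.e. there are $C<\infty$ and $\theta<1$ with $\|R^{-m}\mathcal B_m-e_m\|_{\mathcal H_R}\le C\theta^m$ for all $m$). Moreover $(R^{-m}\mathcal B_m)_{m\ge0}$ is a Riesz basis of $\mathcal H_R$.
   Context: $\mathcal H_R=H^2(D(x_w,R))$ is the Hardy space of the open disk of center $x_w$ and radius $R$, normed so that the $e_m$, $m\geq0$, form an orthonormal basis. Words are finite sequences (possibly empty) of digits in $\{0,\dots,b-1\}$; $|g|$ is the length of $g$; $n(g)$ is the integer represented by $g$ in base $b$ (most significant digit on the left); $x(g)=n(g)b^{-|g|}$; for an infinite digit sequence, $x(d_1d_2\dots)=\sum_id_ib^{-i}$. $k_w(g)$ is the number of occurrences (with overlaps) of $w$ in $g$ as a block of consecutive digits, and $k_w^+(g)=k_w(wg)-1$. $\mathcal G$ is the set of non-empty words $g$ with $k_w^+(g)=1$ and $k_w^+(g^-)=0$, where $g^-$ is $g$ with its last digit deleted. $\lambda_n(w)=\sum_{g\in\mathcal G}b^{-n|g|}$ for $n\ge1$ (these are distinct, $\lambda_1(w)=1$).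 On functions, $(\mathsf K_wf)(x)=\sum_{g\in\mathcal G}b^{-|g|}f(x(g)+b^{-|g|}x)$; $\mathcal B_m$ is the unique monic polynomial of degree $m$ with $\mathsf K_w\mathcal B_m=\lambda_{m+1}(w)\mathcal B_m$. $g_w$ is the (unique) shortest word of $\mathcal G$, and $x_w=x(g_wg_wg_w\cdots)\in[0,1]$. A Riesz basis of a Hilbert space is the image of an orthonormal basis under a bounded invertible operator. *)

theory Defs
  imports "HOL-Complex_Analysis.Complex_Analysis"
begin

definition words :: "nat \<Rightarrow> nat list set" where
  "words b = lists {..<b}"

text \<open>Words are written with the most significant digit first.\<close>

definition word_int :: "nat \<Rightarrow> nat list \<Rightarrow> nat" where
  "word_int b g = (\<Sum>i<length g. g ! i * b ^ (length g - 1 - i))"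

definition word_real :: "nat \<Rightarrow> nat list \<Rightarrow> real" where
  "word_real b g = real (word_int b g) / real b ^ length g"

text \<open>Infinite digit sequences are indexed from 0, hence the shift of the exponent.\<close>

definition seq_real :: "nat \<Rightarrow> (nat \<Rightarrow> nat) \<Rightarrow> real" where
  "seq_real b d = (\<Sum>i. real (d i) / real b ^ Suc i)"

definition occ :: "nat list \<Rightarrow> nat list \<Rightarrow> nat" where
  "occ w g = card {i. i + length w \<le> length g \<and> take (length w) (drop i g) = w}"

text \<open>The subtraction does not truncate, since w is a prefix of w @ g.\<close>

definition occ_plus :: "nat list \<Rightarrow> nat list \<Rightarrow> nat" where
  "occ_plus w g = occ w (w @ g) - 1"

definition return_words :: "nat \<Rightarrow> nat list \<Rightarrow> nat list set" where
  "return_words b w =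
     {g \<in> words b. g \<noteq> [] \<and> occ_plus w g = 1 \<and> occ_plus w (butlast g) = 0}"

definition shortest_word :: "nat \<Rightarrow> nat list \<Rightarrow> nat list" where
  "shortest_word b w =
     (THE g. g \<in> return_words b w \<and> (\<forall>h\<in>return_words b w. length g \<le> length h))"

definition x_pt :: "nat \<Rightarrow> nat list \<Rightarrow> real" where
  "x_pt b w =
     seq_real b (\<lambda>i. shortest_word b w ! (i mod length (shortest_word b w)))"

definition R_min :: "nat \<Rightarrow> nat list \<Rightarrow> real" where
  "R_min b w = max (x_pt b w) (1 - x_pt b w)"

definition eigval :: "nat \<Rightarrow> nat list \<Rightarrow> nat \<Rightarrow> real" where
  "eigval b w n = (\<Sum>\<^sub>\<infinity>g\<in>return_words b w. 1 / real b ^ (n * length g))"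

definition K_op :: "nat \<Rightarrow> nat list \<Rightarrow> (complex \<Rightarrow> complex) \<Rightarrow> complex \<Rightarrow> complex" where
  "K_op b w f x = (\<Sum>\<^sub>\<infinity>g\<in>return_words b w.
      (1 / of_nat b ^ length g) * f (of_real (word_real b g) + x / of_nat b ^ length g))"

definition eigpoly :: "nat \<Rightarrow> nat list \<Rightarrow> nat \<Rightarrow> complex poly" where
  "eigpoly b w m = (THE p. degree p = m \<and> lead_coeff p = 1 \<and>
      (\<forall>x. K_op b w (poly p) x = of_real (eigval b w (m + 1)) * poly p x))"

text \<open>Elements of the Hardy space are represented by functions on the whole plane
  that vanish off the disk, so that equality in the space is equality of functions
  and the norm is definite.\<close>

definition disk_fun :: "complex \<Rightarrow> real \<Rightarrow> (complex \<Rightarrow> complex) \<Rightarrow> complex \<Rightarrow> complex" where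
  "disk_fun c R f = (\<lambda>z. if z \<in> ball c R then f z else 0)"

definition circle_mean :: "complex \<Rightarrow> (complex \<Rightarrow> complex) \<Rightarrow> real \<Rightarrow> complex" where
  "circle_mean c f r = integral {0..2 * pi} (\<lambda>t. f (c + rcis r t)) / of_real (2 * pi)"

definition hardy_space :: "complex \<Rightarrow> real \<Rightarrow> (complex \<Rightarrow> complex) set" where
  "hardy_space c R = {f. f holomorphic_on ball c R \<and> (\<forall>z. z \<notin> ball c R \<longrightarrow> f z = 0) \<and>
     bdd_above ((\<lambda>r. integral {0..2 * pi} (\<lambda>t. (cmod (f (c + rcis r t)))\<^sup>2)) ` {0<..<R})}"

text \<open>On the Hardy space the limit of the circle means exists; for g = f the means
  increase with the radius, so the squared norm is also their supremum.\<close>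

definition hardy_inner ::
  "complex \<Rightarrow> real \<Rightarrow> (complex \<Rightarrow> complex) \<Rightarrow> (complex \<Rightarrow> complex) \<Rightarrow> complex" where
  "hardy_inner c R f g = Lim (at_left R) (circle_mean c (\<lambda>z. f z * cnj (g z)))"

text \<open>A Hilbert space is given by its carrier V, a linear space of functions under the
  pointwise operations, and its inner product ip.\<close>

definition ip_norm :: "('f \<Rightarrow> 'f \<Rightarrow> complex) \<Rightarrow> 'f \<Rightarrow> real" where
  "ip_norm ip f = sqrt (Re (ip f f))"

definition orthonormal_basis ::
  "('a \<Rightarrow> complex) set \<Rightarrow> (('a \<Rightarrow> complex) \<Rightarrow> ('a \<Rightarrow> complex) \<Rightarrow> complex)
     \<Rightarrow> (nat \<Rightarrow> 'a \<Rightarrow> complex) \<Rightarrow> bool" where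
  "orthonormal_basis V ip u \<longleftrightarrow>
     (\<forall>m. u m \<in> V) \<and>
     (\<forall>m n. ip (u m) (u n) = (if m = n then 1 else 0)) \<and>
     (\<forall>f\<in>V. \<forall>\<epsilon>>0. \<exists>N a. ip_norm ip (\<lambda>z. f z - (\<Sum>n<N. a n * u n z)) < \<epsilon>)"

definition bounded_operator ::
  "('a \<Rightarrow> complex) set \<Rightarrow> (('a \<Rightarrow> complex) \<Rightarrow> ('a \<Rightarrow> complex) \<Rightarrow> complex)
     \<Rightarrow> (('a \<Rightarrow> complex) \<Rightarrow> 'a \<Rightarrow> complex) \<Rightarrow> bool" where
  "bounded_operator V ip T \<longleftrightarrow>
     (\<forall>f\<in>V. T f \<in> V) \<and>
     (\<forall>f\<in>V. \<forall>g\<in>V. \<forall>\<alpha> \<beta>. T (\<lambda>z. \<alpha> * f z + \<beta> * g z) = (\<lambda>z. \<alpha> * T f z + \<beta> * T g z)) \<and>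
     (\<exists>C. \<forall>f\<in>V. ip_norm ip (T f) \<le> C * ip_norm ip f)"

definition invertible_operator ::
  "('a \<Rightarrow> complex) set \<Rightarrow> (('a \<Rightarrow> complex) \<Rightarrow> ('a \<Rightarrow> complex) \<Rightarrow> complex)
     \<Rightarrow> (('a \<Rightarrow> complex) \<Rightarrow> 'a \<Rightarrow> complex) \<Rightarrow> bool" where
  "invertible_operator V ip T \<longleftrightarrow> bounded_operator V ip T \<and>
     (\<exists>S. bounded_operator V ip S \<and> (\<forall>f\<in>V. S (T f) = f \<and> T (S f) = f))"

definition riesz_basis ::
  "('a \<Rightarrow> complex) set \<Rightarrow> (('a \<Rightarrow> complex) \<Rightarrow> ('a \<Rightarrow> complex) \<Rightarrow> complex)
     \<Rightarrow> (nat \<Rightarrow> 'a \<Rightarrow> complex) \<Rightarrow> bool" where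
  "riesz_basis V ip v \<longleftrightarrow>
     (\<exists>u T. orthonormal_basis V ip u \<and> invertible_operator V ip T \<and> (\<forall>m. v m = T (u m)))"

definition hardy_monom :: "complex \<Rightarrow> real \<Rightarrow> nat \<Rightarrow> complex \<Rightarrow> complex" where
  "hardy_monom c R m = disk_fun c R (\<lambda>z. (z - c) ^ m / of_real R ^ m)"

definition hardy_eigpoly :: "nat \<Rightarrow> nat list \<Rightarrow> real \<Rightarrow> nat \<Rightarrow> complex \<Rightarrow> complex" where
  "hardy_eigpoly b w R m =
     disk_fun (of_real (x_pt b w)) R (\<lambda>z. poly (eigpoly b w m) z / of_real R ^ m)"

end

theory Submission
  imports Defs
begin

text \<open>In the coordinate \<open>\<zeta> = (z - x_w) / R\<close> the operator acts on polynomials by an upper triangular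
  matrix. Every return word other than the shortest one, \<open>g_w\<close>, has the form \<open>h g_w\<close> with \<open>h\<close>
  non-empty, and \<open>g_w\<close> fixes \<open>x_w\<close>. Dividing row \<open>k\<close> by the contribution \<open>b ^ (- |g_w| (k + 1))\<close>
  of \<open>g_w\<close> therefore leaves the matrix of a sum over maps sending the disk of radius \<open>R\<close> into the disk of
  radius \<open>\<theta> R\<close> with \<open>\<theta> < 1\<close>, and by the binomial theorem its off-diagonal column sums are
  \<open>O(\<theta> ^ m)\<close>. Solving the triangular eigenvector equations by back substitution preserves this decay.
  In the orthonormal basis \<open>e_m\<close> the eigenpolynomials are thus the columns of a unitriangular matrix
  \<open>1 + N\<close> with exponentially small columns; its inverse has the same form, and both are bounded on
  the square summable sequences.\<close>

section \<open>Triangular matrices with exponentially decaying columns\<close>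

text \<open>The denominators in the eigenvector equations are differences of eigenvalues, and the
  lower bound available for them in row k, half of b ^ (- |g_w| (k + 1)), shrinks geometrically with
  k. The row normalization is chosen to cancel exactly this loss. After it g_w has contraction ratio
  1, so its own columns could not decay; centering the disk at the fixed point x_w makes its
  contribution diagonal. For the remaining words, 0 <= x(h) <= 1 - b ^ (- |h|) limits the
  displacement of x_w under h to (1 - b ^ (- |h|)) R_w, and this is where the threshold R_w comes
  from. Infinitely many return words contribute to each entry; Kraft's inequality for the
  prefix-free set of return words controls their total weight. Finally, only the late columns of N
  are known to be small, so 1 + N need not be within reach of a Neumann series; triangularity takes
  the place of smallness.\<close>

no_notation Infinite_Set_Sum.abs_summable_on (infix \<open>abs'_summable'_on\<close> 50)

text \<open>Rows are solved from m - 1 downwards, by induction on the number of solved rows. Row k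
  reads only entries of larger index, so filling in the next lower entry cannot disturb an equation
  that already holds.\<close>

lemma back_substitution_exists:
  fixes c :: "nat \<Rightarrow> nat \<Rightarrow> 'a::comm_ring_1"
  shows "\<exists>q. q m = 1 \<and> (\<forall>k>m. q k = 0) \<and> (\<forall>k<m. q k = (\<Sum>j\<in>{k<..m}. c k j * q j))"
proof -
  have "\<exists>q. q m = 1 \<and> (\<forall>k>m. q k = 0) \<and>
      (\<forall>k. m - i \<le> k \<and> k < m \<longrightarrow> q k = (\<Sum>j\<in>{k<..m}. c k j * q j))" if "i \<le> m" for i
    using that
  proof (induction i)
    case 0
    show ?case by (rule exI[of _ "\<lambda>k. if k = m then 1 else 0"]) auto
  next
    case (Suc i)
    then obtain q where q: "q m = 1" "\<forall>k>m. q k = 0"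
      "\<forall>k. m - i \<le> k \<and> k < m \<longrightarrow> q k = (\<Sum>j\<in>{k<..m}. c k j * q j)" by auto
    define k0 where "k0 = m - Suc i"
    have k0: "k0 < m" "m - i = Suc k0" using Suc.prems by (auto simp: k0_def)
    define q' where "q' = q(k0 := (\<Sum>j\<in>{k0<..m}. c k0 j * q j))"
    have same: "(\<Sum>j\<in>{k<..m}. c k j * q' j) = (\<Sum>j\<in>{k<..m}. c k j * q j)" if "k \<ge> k0" for k
      using that by (intro sum.cong) (auto simp: q'_def)
    have "q' k = (\<Sum>j\<in>{k<..m}. c k j * q' j)" if "k0 \<le> k" "k < m" for k
    proof (cases "k = k0")
      case True
      then show ?thesis unfolding same[OF that(1)] by (simp add: q'_def)
    next
      case False
      then show ?thesis using q(3) that k0 unfolding same[OF that(1)] by (simp add: q'_def)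
    qed
    then show ?case using q k0 by (intro exI[of _ q']) (auto simp: q'_def k0_def[symmetric])
  qed
  from this[of m] show ?thesis by auto
qed

text \<open>The weight is the partial product of 1 + C \<theta> ^ i, bounded because the exponents
  sum to a convergent geometric series. The last factor gives F j = F (j - 1) + C \<theta> ^ j F (j
  - 1), and F (j - 1) dominates both 1 and every earlier F k.\<close>

lemma growth_weight:
  fixes C \<theta> :: real
  assumes "C \<ge> 0" "0 \<le> \<theta>" "\<theta> < 1"
  shows "\<exists>(F :: nat \<Rightarrow> real) M. (\<forall>j. 1 \<le> F j \<and> F j \<le> M) \<and>
    (\<forall>k j. k < j \<longrightarrow> 1 + C * \<theta> ^ j * F k \<le> F j)"
proof -
  define F where "F j = (\<Prod>i\<le>j. 1 + C * \<theta> ^ i)" for j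
  have ge1: "1 \<le> F j" for j
    unfolding F_def by (intro prod_ge_1) (use assms in auto)
  have mono: "F k \<le> F j" if "k \<le> j" for k j
  proof -
    have "F (Suc n) \<ge> F n" for n
    proof -
      have "F (Suc n) = F n * (1 + C * \<theta> ^ Suc n)" by (simp add: F_def)
      moreover have "0 \<le> F n * (C * \<theta> ^ Suc n)" using ge1[of n] assms by simp
      ultimately show ?thesis by (simp add: algebra_simps)
    qed
    then show ?thesis using that by (rule lift_Suc_mono_le)
  qed
  have bd: "F j \<le> exp (C / (1 - \<theta>))" for j
  proof -
    have "F j \<le> (\<Prod>i\<le>j. exp (C * \<theta> ^ i))" unfolding F_def
      by (intro prod_mono) (use assms in \<open>auto simp: add_nonneg_nonneg\<close>)
    also have "\<dots> = exp (C * (\<Sum>i\<le>j. \<theta> ^ i))" by (simp add: exp_sum sum_distrib_left)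
    also have "(\<Sum>i\<le>j. \<theta> ^ i) \<le> 1 / (1 - \<theta>)"
    proof -
      have "(\<Sum>i\<le>j. \<theta> ^ i) \<le> (\<Sum>i. \<theta> ^ i)" by (rule sum_le_suminf) (use assms in auto)
      then show ?thesis using assms by (simp add: suminf_geometric)
    qed
    then have "C * (\<Sum>i\<le>j. \<theta> ^ i) \<le> C * (1 / (1 - \<theta>))"
      using assms(1) by (rule mult_left_mono)
    then have "exp (C * (\<Sum>i\<le>j. \<theta> ^ i)) \<le> exp (C / (1 - \<theta>))" by simp
    finally show ?thesis .
  qed
  have step: "1 + C * \<theta> ^ j * F k \<le> F j" if "k < j" for k j
  proof -
    define n where "n = j - 1"
    have n: "j = Suc n" "k \<le> n" using that by (auto simp: n_def)
    have "1 + C * \<theta> ^ j * F k \<le> F n + C * \<theta> ^ j * F n"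
      using ge1[of n] mono[OF n(2)] assms by (intro add_mono mult_left_mono) auto
    also have "\<dots> = F j" by (simp add: n F_def algebra_simps)
    finally show ?thesis .
  qed
  show ?thesis using ge1 bd step by (intro exI[of _ F] exI[of _ "exp (C / (1 - \<theta>))"]) blast
qed

text \<open>Discrete Gronwall inequality: testing the system of inequalities against the weights of
  \<open>growth_weight\<close> absorbs every off-diagonal term with \<open>j < m\<close>.\<close>

lemma back_substitution_bound:
  fixes A :: "nat \<Rightarrow> nat \<Rightarrow> real" and C \<theta> :: real
  assumes "C \<ge> 0" "0 \<le> \<theta>" "\<theta> < 1"
    and A0: "\<And>k j. A k j \<ge> 0"
    and col: "\<And>j. (\<Sum>k<j. A k j) \<le> C * \<theta> ^ j"
  shows "\<exists>M\<ge>0. \<forall>m (q :: nat \<Rightarrow> real). q m = 1 \<longrightarrow> (\<forall>k. q k \<ge> 0) \<longrightarrow>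
       (\<forall>k<m. q k \<le> (\<Sum>j\<in>{k<..m}. A k j * q j)) \<longrightarrow> (\<Sum>k<m. q k) \<le> M * \<theta> ^ m"
proof -
  obtain F M where F: "\<And>j. 1 \<le> F j" "\<And>j. F j \<le> M"
    "\<And>k j. k < j \<Longrightarrow> 1 + C * \<theta> ^ j * F k \<le> F j"
    using growth_weight[OF assms(1-3)] by blast
  have F0: "0 \<le> F j" for j using F(1)[of j] by linarith
  have M: "M \<ge> 1" using F(1,2)[of 0] by linarith
  have AF: "(\<Sum>k<j. A k j * F k) \<le> F j - 1" for j
  proof (cases j)
    case 0 then show ?thesis using F(1) by simp
  next
    case (Suc n)
    \<comment> \<open>Only the total of column j is controlled, not its single entries, so all
      weights in the column are replaced by the largest one, which is again some F k with k <
      j.\<close>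
    define B where "B = Max (F ` {..<j})"
    have B: "F k \<le> B" if "k < j" for k unfolding B_def using that by auto
    have "B \<in> F ` {..<j}" unfolding B_def using Suc by (intro Max_in) auto
    then obtain k where k: "k < j" "B = F k" by auto
    have "(\<Sum>k<j. A k j * F k) \<le> (\<Sum>k<j. A k j) * B"
      unfolding sum_distrib_right using B A0 by (intro sum_mono mult_left_mono) auto
    also have "\<dots> \<le> C * \<theta> ^ j * B" using col[of j] F(1)[of k] k by (intro mult_right_mono) auto
    also have "\<dots> \<le> F j - 1" using F(3)[OF k(1)] k by simp
    finally show ?thesis .
  qed
  have "(\<Sum>k<m. q k) \<le> C * M * \<theta> ^ m"
    if q: "q m = 1" "\<And>k. q k \<ge> 0" "\<And>k. k < m \<Longrightarrow> q k \<le> (\<Sum>j\<in>{k<..m}. A k j * q j)" for m q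
  proof -
    have "(\<Sum>k<m. q k * F k) \<le> (\<Sum>k<m. (\<Sum>j\<in>{k<..m}. A k j * q j) * F k)"
      using q(3) F0 by (intro sum_mono mult_right_mono) auto
    also have "\<dots> = (\<Sum>k<m. \<Sum>j\<in>{k<..m}. A k j * F k * q j)"
      unfolding sum_distrib_right by (intro sum.cong) (auto simp: mult_ac)
    also have "\<dots> = (\<Sum>j\<le>m. \<Sum>k<j. A k j * F k * q j)"
    proof -
      have "(\<Sum>k<m. \<Sum>j\<in>{k<..m}. A k j * F k * q j) =
          (\<Sum>(k, j)\<in>(SIGMA k:{..<m}. {k<..m}). A k j * F k * q j)"
        by (rule sum.Sigma) auto
      also have "\<dots> = (\<Sum>(j, k)\<in>(SIGMA j:{..m}. {..<j}). A k j * F k * q j)"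
        by (rule sum.reindex_bij_witness[of _ "\<lambda>(j, k). (k, j)" "\<lambda>(k, j). (j, k)"]) auto
      also have "\<dots> = (\<Sum>j\<le>m. \<Sum>k<j. A k j * F k * q j)"
        by (rule sum.Sigma[symmetric]) auto
      finally show ?thesis .
    qed
    also have "\<dots> = (\<Sum>j\<le>m. (\<Sum>k<j. A k j * F k) * q j)" by (simp add: sum_distrib_right)
    also have "\<dots> = (\<Sum>j<m. (\<Sum>k<j. A k j * F k) * q j) + (\<Sum>k<m. A k m * F k)"
      by (simp add: lessThan_Suc_atMost[symmetric] q(1))
    also have "\<dots> \<le> (\<Sum>j<m. (F j - 1) * q j) + (\<Sum>k<m. A k m) * M"
      unfolding sum_distrib_right[of _ _ M] using AF q F(2) A0
      by (intro add_mono sum_mono mult_right_mono mult_left_mono) auto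
    also have "\<dots> \<le> (\<Sum>j<m. (F j - 1) * q j) + C * \<theta> ^ m * M"
      using col[of m] M by (intro add_left_mono mult_right_mono) auto
    \<comment> \<open>Each q j with j < m carries weight F j on the left and F j - 1 on the right,
      so cancellation leaves the unweighted sum; only column m, where q is 1, remains on the
      right.\<close>
    finally show ?thesis by (simp add: sum_subtractf algebra_simps)
  qed
  moreover have "C * M \<ge> 0" using assms M by simp
  ultimately show ?thesis by (intro exI[of _ "C * M"]) auto
qed

section \<open>Infinite matrices 1 + N acting on bounded sequences\<close>

definition unit_op :: "(nat \<Rightarrow> nat \<Rightarrow> complex) \<Rightarrow> (nat \<Rightarrow> complex) \<Rightarrow> nat \<Rightarrow> complex" where
  "unit_op N a k = a k + (\<Sum>\<^sub>\<infinity>m. N k m * a m)"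

text \<open>Joint summability of all entries serves two purposes: it licenses exchanging double
  sums, and it makes the row sums summable, which gives boundedness on l2.\<close>

definition abs_mat :: "(nat \<Rightarrow> nat \<Rightarrow> complex) \<Rightarrow> bool" where
  "abs_mat N \<longleftrightarrow> (\<lambda>(k, m). N k m) abs_summable_on UNIV"

lemma abs_mat_row: "abs_mat N \<Longrightarrow> (\<lambda>m. N k m) abs_summable_on UNIV"
  using summable_on_SigmaD1[of "\<lambda>k m. cmod (N k m)" UNIV "\<lambda>_. UNIV" k]
  by (simp add: abs_mat_def case_prod_unfold)

lemma abs_mat_row_mult:
  assumes "abs_mat N" "\<And>m. cmod (a m) \<le> B"
  shows "(\<lambda>m. N k m * a m) abs_summable_on UNIV"
proof (rule Infinite_Sum.abs_summable_on_comparison_test)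
  show "(\<lambda>m. of_real B * N k m) abs_summable_on UNIV"
    using abs_mat_row[OF assms(1), of k] by (simp add: norm_mult summable_on_cmult_right)
  fix m
  have "0 \<le> B" using assms(2)[of m] norm_ge_zero order_trans by blast
  then show "cmod (N k m * a m) \<le> cmod (of_real B * N k m)"
    using mult_left_mono[OF assms(2)[of m], of "cmod (N k m)"] by (simp add: norm_mult mult_ac)
qed

lemma unit_op_linear:
  assumes "abs_mat N" "\<And>m. cmod (a m) \<le> A" "\<And>m. cmod (b m) \<le> B"
  shows "unit_op N (\<lambda>m. x * a m + y * b m) k = x * unit_op N a k + y * unit_op N b k"
proof -
  have sa: "(\<lambda>m. N k m * a m) summable_on UNIV" "(\<lambda>m. N k m * b m) summable_on UNIV"
    by (rule abs_summable_summable[OF abs_mat_row_mult[OF assms(1)]], rule assms)+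
  have "(\<Sum>\<^sub>\<infinity>m. N k m * (x * a m + y * b m)) =
        (\<Sum>\<^sub>\<infinity>m. x * (N k m * a m) + y * (N k m * b m))"
    by (simp add: algebra_simps)
  also have "\<dots> = x * (\<Sum>\<^sub>\<infinity>m. N k m * a m) + y * (\<Sum>\<^sub>\<infinity>m. N k m * b m)"
    using sa by (simp add: infsum_add summable_on_cmult_right infsum_cmult_right)
  finally show ?thesis by (simp add: unit_op_def algebra_simps)
qed

lemma unit_op_diff_bound:
  assumes "abs_mat N" "\<And>m. cmod (a m) \<le> B"
  shows "cmod (unit_op N a k - a k) \<le> B * (\<Sum>\<^sub>\<infinity>m. cmod (N k m))"
proof -
  have "cmod (\<Sum>\<^sub>\<infinity>m. N k m * a m) \<le> (\<Sum>\<^sub>\<infinity>m. cmod (N k m * a m))"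
    by (rule norm_infsum_bound[OF abs_mat_row_mult[OF assms]])
  also have "\<dots> \<le> (\<Sum>\<^sub>\<infinity>m. B * cmod (N k m))"
  proof (rule infsum_mono)
    show "(\<lambda>m. cmod (N k m * a m)) summable_on UNIV" by (rule abs_mat_row_mult[OF assms])
    show "(\<lambda>m. B * cmod (N k m)) summable_on UNIV"
      by (rule summable_on_cmult_right[OF abs_mat_row[OF assms(1)]])
    show "cmod (N k m * a m) \<le> B * cmod (N k m)" for m
      using mult_right_mono[OF assms(2)[of m], of "cmod (N k m)"] by (simp add: norm_mult mult_ac)
  qed
  also have "\<dots> = B * (\<Sum>\<^sub>\<infinity>m. cmod (N k m))"
    using abs_mat_row[OF assms(1), of k] by (simp add: infsum_cmult_right)
  finally show ?thesis by (simp add: unit_op_def)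
qed

text \<open>Hypothesis \<open>inv\<close> is the entrywise form of (1 + N)(1 + W) = 1. Passing from
  entries to operators is a Fubini exchange, valid on bounded sequences because row k of N and the
  sequence are bounded while W is jointly summable.\<close>

lemma unit_op_comp:
  assumes N: "abs_mat N" and W: "abs_mat W" and a: "\<And>m. cmod (a m) \<le> B"
    and inv: "\<And>k j. W k j + N k j + (\<Sum>\<^sub>\<infinity>m. N k m * W m j) = 0"
  shows "unit_op N (unit_op W a) = a"
proof
  fix k
  obtain C where C: "\<And>m. cmod (N k m) \<le> C"
  proof -
    have "cmod (N k m) \<le> (\<Sum>\<^sub>\<infinity>m. cmod (N k m))" for m
      using finite_sum_le_infsum[OF abs_mat_row[OF N, of k], of "{m}"] by simp
    then show ?thesis using that by blast
  qed
  have B: "B \<ge> 0" using a[of 0] norm_ge_zero order_trans by blast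
  have C0: "C \<ge> 0" using C[of 0] norm_ge_zero order_trans by blast
  have "(\<lambda>(m, j). N k m * W m j * a j) abs_summable_on UNIV \<times> UNIV"
  proof (rule Infinite_Sum.abs_summable_on_comparison_test)
    show "(\<lambda>(m, j). of_real (C * B) * W m j) abs_summable_on UNIV \<times> UNIV"
      using summable_on_cmult_right[OF W[unfolded abs_mat_def], of "C * B"] B C0
      by (simp add: case_prod_unfold norm_mult)
    fix x :: "nat \<times> nat" assume "x \<in> UNIV \<times> UNIV"
    obtain m j where x: "x = (m, j)" by (cases x)
    have "cmod (N k m) * cmod (a j) * cmod (W m j) \<le> C * B * cmod (W m j)"
      using C a C0 by (intro mult_right_mono mult_mono) auto
    then show "cmod (case x of (m, j) \<Rightarrow> N k m * W m j * a j)
        \<le> cmod (case x of (m, j) \<Rightarrow> of_real (C * B) * W m j)"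
      using B C0 by (simp add: x norm_mult mult_ac)
  qed
  then have dbl: "(\<lambda>(m, j). N k m * W m j * a j) summable_on UNIV \<times> UNIV"
    by (rule abs_summable_summable)
  have sNa: "(\<lambda>m. N k m * a m) summable_on UNIV" and sWa: "(\<lambda>m. W k m * a m) summable_on UNIV"
    by (rule abs_summable_summable[OF abs_mat_row_mult[OF _ a]], fact)+
  have inner: "(\<lambda>m. \<Sum>\<^sub>\<infinity>j. N k m * W m j * a j) summable_on UNIV"
    using summable_on_Sigma_banach[OF dbl] by simp
  have inner': "(\<lambda>j. \<Sum>\<^sub>\<infinity>m. N k m * W m j * a j) summable_on UNIV"
  proof -
    have "(\<lambda>(j, m). N k m * W m j * a j) summable_on UNIV \<times> UNIV"
      using dbl by (subst (asm) summable_on_swap) (simp add: case_prod_unfold)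
    from summable_on_Sigma_banach[OF this] show ?thesis by simp
  qed
  have pull: "N k m * (\<Sum>\<^sub>\<infinity>j. W m j * a j) = (\<Sum>\<^sub>\<infinity>j. N k m * W m j * a j)" for m
    by (simp add: infsum_cmult_right'[symmetric] mult.assoc)
  have "unit_op N (unit_op W a) k = a k + (\<Sum>\<^sub>\<infinity>j. W k j * a j)
      + (\<Sum>\<^sub>\<infinity>m. N k m * a m + (\<Sum>\<^sub>\<infinity>j. N k m * W m j * a j))"
    unfolding unit_op_def by (simp add: distrib_left pull)
  also have "\<dots> = a k + (\<Sum>\<^sub>\<infinity>j. W k j * a j)
      + ((\<Sum>\<^sub>\<infinity>m. N k m * a m) + (\<Sum>\<^sub>\<infinity>m. \<Sum>\<^sub>\<infinity>j. N k m * W m j * a j))"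
    using sNa inner by (simp add: infsum_add)
  also have "(\<Sum>\<^sub>\<infinity>m. \<Sum>\<^sub>\<infinity>j. N k m * W m j * a j) = (\<Sum>\<^sub>\<infinity>j. \<Sum>\<^sub>\<infinity>m. N k m * W m j * a j)"
    by (rule infsum_swap_banach[OF dbl])
  also have "a k + (\<Sum>\<^sub>\<infinity>j. W k j * a j) + ((\<Sum>\<^sub>\<infinity>m. N k m * a m) + \<dots>) =
      a k + (\<Sum>\<^sub>\<infinity>j. W k j * a j + N k j * a j + (\<Sum>\<^sub>\<infinity>m. N k m * W m j * a j))"
    using sNa sWa inner' by (simp add: infsum_add summable_on_add)
  also have "(\<lambda>j. W k j * a j + N k j * a j + (\<Sum>\<^sub>\<infinity>m. N k m * W m j * a j)) = (\<lambda>j. 0)"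
  proof
    fix j
    have "W k j * a j + N k j * a j + (\<Sum>\<^sub>\<infinity>m. N k m * W m j * a j) =
        (W k j + N k j + (\<Sum>\<^sub>\<infinity>m. N k m * W m j)) * a j"
      by (simp add: infsum_cmult_left' distrib_right)
    then show "W k j * a j + N k j * a j + (\<Sum>\<^sub>\<infinity>m. N k m * W m j * a j) = 0"
      by (simp add: inv)
  qed
  finally show "unit_op N (unit_op W a) k = a k" by simp
qed

text \<open>This class contains, together with N, the strictly triangular part of the inverse of 1 +
  N, so existence of inverses can be applied twice.\<close>

definition strict_tri :: "(nat \<Rightarrow> nat \<Rightarrow> complex) \<Rightarrow> bool" where
  "strict_tri N \<longleftrightarrow> (\<forall>k m. m \<le> k \<longrightarrow> N k m = 0) \<and>
     (\<exists>C \<theta>. 0 \<le> C \<and> 0 \<le> \<theta> \<and> \<theta> < 1 \<and> (\<forall>m. (\<Sum>k<m. cmod (N k m)) \<le> C * \<theta> ^ m))"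

lemma strict_tri_abs_mat:
  assumes "strict_tri N"
  shows "abs_mat N"
proof -
  obtain C \<theta> where N0: "\<And>k m. m \<le> k \<Longrightarrow> N k m = 0" and C: "0 \<le> C" "0 \<le> \<theta>" "\<theta> < 1"
    "\<And>m. (\<Sum>k<m. cmod (N k m)) \<le> C * \<theta> ^ m"
    using assms unfolding strict_tri_def by blast
  have "(\<lambda>(m, k). cmod (N k m)) summable_on UNIV \<times> UNIV"
  proof (rule summable_on_SigmaI)
    show "((\<lambda>k. case (m, k) of (m, k) \<Rightarrow> cmod (N k m)) has_sum (\<Sum>k<m. cmod (N k m))) UNIV" for m
      by (rule has_sum_finite_neutralI[of "{..<m}"]) (auto simp: N0)
    have "summable (\<lambda>m. C * \<theta> ^ m)" using C by (simp add: summable_mult)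
    then have "summable (\<lambda>m. \<Sum>k<m. cmod (N k m))"
      by (rule summable_comparison_test[rotated]) (use C in \<open>auto simp: sum_nonneg\<close>)
    then show "(\<lambda>m. \<Sum>k<m. cmod (N k m)) summable_on UNIV"
      by (subst summable_on_UNIV_nonneg_real_iff) (auto simp: sum_nonneg)
  qed auto
  then have "(\<lambda>(k, m). cmod (N k m)) summable_on UNIV \<times> UNIV"
    by (subst summable_on_swap) (simp add: case_prod_unfold)
  then show ?thesis by (simp add: abs_mat_def case_prod_unfold)
qed

text \<open>Column m of the inverse solves (1 + N) q = e_m, which is back substitution with
  coefficients - N. The Gronwall bound applied to absolute values returns the same rate
  \<theta>.\<close>

lemma strict_tri_right_inverse:
  assumes "strict_tri N"
  obtains W where "strict_tri W" "\<And>a B. (\<And>m. cmod (a m) \<le> B) \<Longrightarrow> unit_op N (unit_op W a) = a"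
proof -
  obtain C \<theta> where N0: "\<And>k m. m \<le> k \<Longrightarrow> N k m = 0" and C: "0 \<le> C" "0 \<le> \<theta>" "\<theta> < 1"
    "\<And>m. (\<Sum>k<m. cmod (N k m)) \<le> C * \<theta> ^ m"
    using assms unfolding strict_tri_def by blast
  define Q where "Q m = (SOME q. q m = 1 \<and> (\<forall>k>m. q k = 0) \<and>
      (\<forall>k<m. q k = (\<Sum>j\<in>{k<..m}. - N k j * q j)))" for m
  have Q: "Q m m = 1" "m < k \<Longrightarrow> Q m k = 0" "k < m \<Longrightarrow> Q m k = (\<Sum>j\<in>{k<..m}. - N k j * Q m j)" for m k
    using someI_ex[OF back_substitution_exists[of m "\<lambda>k j. - N k j"]] unfolding Q_def by blast+
  obtain M where M: "M \<ge> 0"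
    "\<forall>m (q :: nat \<Rightarrow> real). q m = 1 \<longrightarrow> (\<forall>k. q k \<ge> 0) \<longrightarrow>
       (\<forall>k<m. q k \<le> (\<Sum>j\<in>{k<..m}. cmod (N k j) * q j)) \<longrightarrow> (\<Sum>k<m. q k) \<le> M * \<theta> ^ m"
    using back_substitution_bound[OF C(1-3), of "\<lambda>k j. cmod (N k j)", OF norm_ge_zero C(4)] by blast
  have Qb: "(\<Sum>k<m. cmod (Q m k)) \<le> M * \<theta> ^ m" for m
  proof (rule M(2)[rule_format])
    fix k assume "k < m"
    then show "cmod (Q m k) \<le> (\<Sum>j\<in>{k<..m}. cmod (N k j) * cmod (Q m j))"
      unfolding Q(3)[OF \<open>k < m\<close>] by (intro sum_norm_le) (simp add: norm_mult)
  qed (simp_all add: Q(1))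
  define W where "W k m = (if k < m then Q m k else 0)" for k m
  have W: "strict_tri W" unfolding strict_tri_def
    by (intro conjI exI[of _ M] exI[of _ \<theta>]) (use M(1) C(1-3) Qb in \<open>auto simp: W_def\<close>)
  have inv: "W k j + N k j + (\<Sum>\<^sub>\<infinity>m. N k m * W m j) = 0" for k j
  proof (cases "k < j")
    case False
    then have "(\<lambda>m. N k m * W m j) = (\<lambda>m. 0)" by (auto simp: W_def N0 fun_eq_iff)
    then show ?thesis using False by (simp add: W_def N0)
  next
    case True
    have "(\<Sum>\<^sub>\<infinity>m. N k m * W m j) = (\<Sum>m\<in>{k<..<j}. N k m * Q j m)"
      by (rule infsumI, rule has_sum_finite_neutralI[of "{k<..<j}"]) (auto simp: W_def N0)
    moreover have "{k<..j} = insert j {k<..<j}" using True by auto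
    ultimately show ?thesis using Q(3)[OF True] True
      by (simp add: W_def Q(1) sum_negf)
  qed
  show ?thesis
    using that[OF W] unit_op_comp[OF strict_tri_abs_mat[OF assms] strict_tri_abs_mat[OF W] _ inv] by blast
qed

section \<open>Square summable sequences\<close>

definition l2 :: "(nat \<Rightarrow> complex) set" where
  "l2 = {a. summable (\<lambda>n. (cmod (a n))\<^sup>2)}"

definition l2norm :: "(nat \<Rightarrow> complex) \<Rightarrow> real" where
  "l2norm a = sqrt (\<Sum>n. (cmod (a n))\<^sup>2)"

lemma l2_bounded: "a \<in> l2 \<Longrightarrow> cmod (a n) \<le> l2norm a"
  using sum_le_suminf[of "\<lambda>n. (cmod (a n))\<^sup>2" "{n}"]
  by (auto simp: l2_def l2norm_def intro!: real_le_rsqrt)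

lemma l2_add_bound:
  assumes "a \<in> l2" "b \<in> l2"
  shows "(\<lambda>n. a n + b n) \<in> l2" "(l2norm (\<lambda>n. a n + b n))\<^sup>2 \<le> 2 * (l2norm a)\<^sup>2 + 2 * (l2norm b)\<^sup>2"
proof -
  have le: "(cmod (a n + b n))\<^sup>2 \<le> 2 * (cmod (a n))\<^sup>2 + 2 * (cmod (b n))\<^sup>2" for n
  proof -
    have "(cmod (a n + b n))\<^sup>2 \<le> (cmod (a n) + cmod (b n))\<^sup>2"
      by (intro power_mono norm_triangle_ineq) auto
    also have "\<dots> \<le> 2 * (cmod (a n))\<^sup>2 + 2 * (cmod (b n))\<^sup>2"
      using zero_le_power2[of "cmod (a n) - cmod (b n)"] by (simp add: power2_sum power2_diff)
    finally show ?thesis .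
  qed
  have s: "summable (\<lambda>n. 2 * (cmod (a n))\<^sup>2 + 2 * (cmod (b n))\<^sup>2)"
    using assms by (intro summable_add summable_mult) (auto simp: l2_def)
  have "summable (\<lambda>n. (cmod (a n + b n))\<^sup>2)"
    by (rule summable_comparison_test[OF _ s]) (use le in auto)
  then show "(\<lambda>n. a n + b n) \<in> l2" by (simp add: l2_def)
  have "(\<Sum>n. (cmod (a n + b n))\<^sup>2) \<le> (\<Sum>n. 2 * (cmod (a n))\<^sup>2 + 2 * (cmod (b n))\<^sup>2)"
    by (rule suminf_le) fact+
  also have "\<dots> = 2 * (\<Sum>n. (cmod (a n))\<^sup>2) + 2 * (\<Sum>n. (cmod (b n))\<^sup>2)"
    using assms by (simp add: l2_def suminf_add[symmetric] suminf_mult summable_mult)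
  finally show "(l2norm (\<lambda>n. a n + b n))\<^sup>2 \<le> 2 * (l2norm a)\<^sup>2 + 2 * (l2norm b)\<^sup>2"
    using assms \<open>summable (\<lambda>n. (cmod (a n + b n))\<^sup>2)\<close> by (simp add: l2norm_def l2_def suminf_nonneg)
qed

lemma l2_scale: "a \<in> l2 \<Longrightarrow> (\<lambda>n. x * a n) \<in> l2"
  by (simp add: l2_def norm_mult power_mult_distrib summable_mult)

lemma l2_lin: "a \<in> l2 \<Longrightarrow> b \<in> l2 \<Longrightarrow> (\<lambda>n. x * a n + y * b n) \<in> l2"
  by (intro l2_add_bound(1) l2_scale)

text \<open>The embedding of l1 into l2: every r n is at most the total sum S, so the squares are
  dominated by S r n.\<close>

lemma l2_of_abs_summable:
  assumes "summable r" "\<And>n. cmod (a n) \<le> r n"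
  shows "a \<in> l2" "l2norm a \<le> suminf r"
proof -
  have r0: "0 \<le> r n" for n using assms(2)[of n] norm_ge_zero order_trans by blast
  have le: "r n \<le> suminf r" for n using sum_le_suminf[OF assms(1), of "{n}"] r0 by simp
  have le2: "(cmod (a n))\<^sup>2 \<le> suminf r * r n" for n
  proof -
    have "(cmod (a n))\<^sup>2 \<le> (r n)\<^sup>2" using assms(2) by (intro power_mono) auto
    also have "\<dots> \<le> suminf r * r n" using le r0 by (simp add: power2_eq_square mult_right_mono)
    finally show ?thesis .
  qed
  have s: "summable (\<lambda>n. suminf r * r n)" using assms(1) by (rule summable_mult)
  have s': "summable (\<lambda>n. (cmod (a n))\<^sup>2)" by (rule summable_comparison_test[OF _ s]) (use le2 in auto)
  then show "a \<in> l2" by (simp add: l2_def)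
  have "(\<Sum>n. (cmod (a n))\<^sup>2) \<le> suminf r * suminf r"
    using suminf_le[OF le2 s' s] suminf_mult[OF assms(1)] by simp
  then show "l2norm a \<le> suminf r" unfolding l2norm_def
    using suminf_nonneg[OF assms(1) r0] by (intro real_le_lsqrt) (auto simp: power2_eq_square)
qed

text \<open>The difference from the identity maps even bounded sequences into l1, being dominated by
  the supremum times the summable row sums of N. The constant under the square root stems from (x +
  y)^2 <= 2 x^2 + 2 y^2, which stands in for the triangle inequality.\<close>

lemma unit_op_l2:
  assumes N: "abs_mat N"
  obtains C where "\<And>a. a \<in> l2 \<Longrightarrow> unit_op N a \<in> l2"
    "\<And>a. a \<in> l2 \<Longrightarrow> l2norm (unit_op N a) \<le> C * l2norm a"
proof -
  define r where "r k = (\<Sum>\<^sub>\<infinity>m. cmod (N k m))" for k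
  have "r summable_on UNIV"
    using summable_on_Sigma_banach[of "\<lambda>k m. cmod (N k m)" UNIV "\<lambda>_. UNIV"] N
    by (simp add: abs_mat_def r_def[abs_def] case_prod_unfold)
  then have r: "summable r" by (rule summable_on_imp_summable)
  have *: "unit_op N a \<in> l2 \<and> (l2norm (unit_op N a))\<^sup>2 \<le> (2 + 2 * (suminf r)\<^sup>2) * (l2norm a)\<^sup>2"
    if a: "a \<in> l2" for a
  proof -
    define d where "d k = unit_op N a k - a k" for k
    have d: "cmod (d k) \<le> l2norm a * r k" for k
      unfolding d_def r_def by (rule unit_op_diff_bound[OF N l2_bounded[OF a]])
    have d2: "d \<in> l2" "l2norm d \<le> l2norm a * suminf r"
      using l2_of_abs_summable[OF summable_mult[OF r] d] suminf_mult[OF r] by auto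
    have "unit_op N a = (\<lambda>k. a k + d k)" by (simp add: d_def)
    moreover have "(l2norm d)\<^sup>2 \<le> (l2norm a * suminf r)\<^sup>2"
      using d2 by (intro power_mono) (auto simp: l2norm_def suminf_nonneg d2(1)[unfolded l2_def, simplified])
    ultimately show ?thesis using l2_add_bound[OF a d2(1)] by (simp add: algebra_simps power_mult_distrib)
  qed
  have "l2norm (unit_op N a) \<le> sqrt (2 + 2 * (suminf r)\<^sup>2) * l2norm a" if "a \<in> l2" for a
  proof (rule power2_le_imp_le)
    show "(l2norm (unit_op N a))\<^sup>2 \<le> (sqrt (2 + 2 * (suminf r)\<^sup>2) * l2norm a)\<^sup>2"
      using *[OF that] by (simp add: power_mult_distrib)
    show "0 \<le> sqrt (2 + 2 * (suminf r)\<^sup>2) * l2norm a"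
      using that by (auto simp: l2norm_def l2_def intro!: mult_nonneg_nonneg suminf_nonneg)
  qed
  with * that show ?thesis by blast
qed

section \<open>The Hardy space of a disk\<close>

text \<open>The synthesis map from coefficients in the basis e_n to functions, cut off outside the
  disk to match the representatives used in \<open>hardy_space\<close>.\<close>

definition synth :: "complex \<Rightarrow> real \<Rightarrow> (nat \<Rightarrow> complex) \<Rightarrow> complex \<Rightarrow> complex" where
  "synth c R a = disk_fun c R (\<lambda>z. \<Sum>n. a n * ((z - c) / of_real R) ^ n)"

text \<open>The growth condition on coefficients of arbitrary holomorphic functions on the disk. It
  allows Parseval's identity on smaller circles before square summability is known.\<close>

definition powser_conv :: "(nat \<Rightarrow> complex) \<Rightarrow> bool" where
  "powser_conv a \<longleftrightarrow> (\<forall>\<rho>. 0 \<le> \<rho> \<longrightarrow> \<rho> < 1 \<longrightarrow> summable (\<lambda>n. cmod (a n) * \<rho> ^ n))"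

lemma powser_conv_l2: assumes "a \<in> l2" shows "powser_conv a"
  unfolding powser_conv_def
proof (intro allI impI)
  fix \<rho> :: real assume \<rho>: "0 \<le> \<rho>" "\<rho> < 1"
  have "summable (\<lambda>n. l2norm a * \<rho> ^ n)" using \<rho> by (simp add: summable_mult)
  then show "summable (\<lambda>n. cmod (a n) * \<rho> ^ n)"
    by (rule summable_comparison_test[rotated])
      (use \<rho> l2_bounded[OF assms] in \<open>auto intro!: mult_right_mono\<close>)
qed

lemma powser_conv_summable:
  assumes "powser_conv a" "cmod z < 1"
  shows "summable (\<lambda>n. a n * z ^ n)"
  by (rule summable_norm_cancel) (use assms in \<open>simp add: powser_conv_def norm_mult norm_power\<close>)

lemma cis_orthogonal:
  "((\<lambda>t. cis (real n * t) * cnj (cis (real m * t))) has_integral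
     (if n = m then of_real (2 * pi) else 0)) {0..2 * pi}"
proof (cases "n = m")
  case True
  have "((\<lambda>t. 1 :: complex) has_integral (2 * pi - 0) *\<^sub>R 1) {0..2 * pi}"
    using has_integral_const_real[of "1 :: complex" 0 "2 * pi"] by simp
  then show ?thesis using True by (simp add: cis_cnj cis_mult scaleR_conv_of_real)
next
  case False
  define k where "k = real n - real m"
  have k: "k \<noteq> 0" using False by (simp add: k_def)
  define f where "f z = exp (\<i> * of_real k * z) / (\<i> * of_real k)" for z
  have "(f has_field_derivative exp (\<i> * of_real k * z)) (at z)" for z
    unfolding f_def by (rule derivative_eq_intros refl | use k in simp)+
  then have "((\<lambda>t. f (of_real t)) has_vector_derivative exp (\<i> * of_real k * of_real t)) (at t within S)" for t S
    by (rule has_vector_derivative_real_field)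
  then have "((\<lambda>t. exp (\<i> * of_real k * of_real t)) has_integral f (of_real (2 * pi)) - f (of_real 0)) {0..2 * pi}"
    by (intro fundamental_theorem_of_calculus) auto
  moreover have "f (of_real (2 * pi)) = f (of_real 0)"
  proof -
    have "exp (\<i> * of_real k * of_real (2 * pi)) = exp (2 * of_int (int n - int m) * of_real pi * \<i>)"
      by (simp add: k_def algebra_simps)
    also have "\<dots> = 1" unfolding exp_eq_1 by (auto intro!: exI[of _ "int n - int m"])
    finally show ?thesis by (simp add: f_def)
  qed
  moreover have "exp (\<i> * of_real k * of_real t) = cis (real n * t) * cnj (cis (real m * t))" for t
  proof -
    have "exp (\<i> * of_real k * of_real t) = cis (real n * t - real m * t)"
      by (simp add: k_def cis_conv_exp left_diff_distrib right_diff_distrib mult_ac)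
    then show ?thesis by (simp add: cis_cnj cis_mult)
  qed
  ultimately show ?thesis using False by simp
qed

text \<open>On a circle strictly inside the disk both series converge uniformly by the M-test, so
  the product of partial sums may be integrated first and the limit taken afterwards. The
  sesquilinear form is what the inner product requires.\<close>

lemma parseval_circle:
  assumes R: "R > 0" and a: "powser_conv a" and b: "powser_conv b" and \<rho>: "0 \<le> \<rho>" "\<rho> < 1"
  shows "summable (\<lambda>n. a n * cnj (b n) * of_real (\<rho> ^ (2 * n)))"
    and "((\<lambda>t. synth c R a (c + rcis (\<rho> * R) t) * cnj (synth c R b (c + rcis (\<rho> * R) t))) has_integral
      of_real (2 * pi) * (\<Sum>n. a n * cnj (b n) * of_real (\<rho> ^ (2 * n)))) {0..2 * pi}"
proof -
  define P where "P a N t = (\<Sum>n<N. a n * of_real (\<rho> ^ n) * cis (real n * t))" for a :: "nat \<Rightarrow> complex" and N t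
  define L where "L a t = (\<Sum>n. a n * of_real (\<rho> ^ n) * cis (real n * t))" for a :: "nat \<Rightarrow> complex" and t
  have synth: "synth c R a (c + rcis (\<rho> * R) t) = L a t" for a t
  proof -
    have "c + rcis (\<rho> * R) t \<in> ball c R" using R \<rho> by (simp add: dist_norm)
    moreover have "((c + rcis (\<rho> * R) t - c) / of_real R) ^ n = of_real (\<rho> ^ n) * cis (real n * t)" for n
      using R by (simp add: rcis_def power_mult_distrib Complex.DeMoivre)
    ultimately show ?thesis by (simp add: synth_def disk_fun_def L_def mult.assoc)
  qed
  have u: "uniform_limit {0..2*pi} (P a) (L a) sequentially" if "powser_conv a" for a
    unfolding P_def L_def
  proof (rule Weierstrass_m_test)
    show "summable (\<lambda>n. cmod (a n) * \<rho> ^ n)" using that \<rho> by (simp add: powser_conv_def)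
  qed (use \<rho> in \<open>simp add: norm_mult norm_power\<close>)
  have cP: "continuous_on {0..2*pi} (P a N)" for a N
    unfolding P_def cis_conv_exp by (intro continuous_intros)
  have cL: "bounded (L a ` {0..2*pi})" if "powser_conv a" for a
    by (rule compact_imp_bounded, rule compact_continuous_image,
        rule uniform_limit_theorem[OF _ u[OF that]]) (auto intro!: always_eventually cP)
  have cnj_u: "uniform_limit {0..2*pi} (\<lambda>N t. cnj (P b N t)) (\<lambda>t. cnj (L b t)) sequentially"
    using u[OF b] by (rule bounded_linear.uniform_limit[OF bounded_linear_cnj])
  have cnj_b: "bounded ((\<lambda>t. cnj (L b t)) ` {0..2*pi})"
    using cL[OF b] by (auto simp: bounded_iff)
  have "uniform_limit {0..2*pi} (\<lambda>N t. P a N t * cnj (P b N t)) (\<lambda>t. L a t * cnj (L b t)) sequentially"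
    using uniform_lim_mult[OF u[OF a] cnj_u cL[OF a] cnj_b] .
  then obtain I J where IJ: "\<And>N. ((\<lambda>t. P a N t * cnj (P b N t)) has_integral I N) {0..2*pi}"
      "((\<lambda>t. L a t * cnj (L b t)) has_integral J) {0..2*pi}" "I \<longlonglongrightarrow> J"
    by (rule uniform_limit_integral) (auto intro!: continuous_intros cP)
  define h where "h n = a n * cnj (b n) * of_real (\<rho> ^ (2 * n))" for n
  have I: "I N = of_real (2 * pi) * (\<Sum>n<N. h n)" for N
  proof -
    have "((\<lambda>t. \<Sum>n<N. \<Sum>m<N. (a n * cnj (b m) * of_real (\<rho> ^ n * \<rho> ^ m)) *
          (cis (real n * t) * cnj (cis (real m * t)))) has_integral
        (\<Sum>n<N. \<Sum>m<N. (a n * cnj (b m) * of_real (\<rho> ^ n * \<rho> ^ m)) *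
          (if n = m then of_real (2 * pi) else 0))) {0..2*pi}"
      by (intro has_integral_sum has_integral_mult_right cis_orthogonal) auto
    moreover have "(\<lambda>t. \<Sum>n<N. \<Sum>m<N. (a n * cnj (b m) * of_real (\<rho> ^ n * \<rho> ^ m)) *
          (cis (real n * t) * cnj (cis (real m * t)))) = (\<lambda>t. P a N t * cnj (P b N t))"
      by (simp add: P_def sum_product mult_ac)
    moreover have "(\<Sum>n<N. \<Sum>m<N. (a n * cnj (b m) * of_real (\<rho> ^ n * \<rho> ^ m)) *
          (if n = m then of_real (2 * pi) else 0)) = of_real (2 * pi) * (\<Sum>n<N. h n)"
    proof -
      have delta: "(\<Sum>m<N. f m * (if n = m then x else 0)) = f n * x" if "n < N"
        for f :: "nat \<Rightarrow> complex" and n x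
      proof -
        have "(\<Sum>m<N. f m * (if n = m then x else 0)) = (\<Sum>m<N. if n = m then f m * x else 0)"
          by (rule sum.cong) auto
        then show ?thesis using that by (simp add: sum.delta')
      qed
      show ?thesis unfolding sum_distrib_left
      proof (rule sum.cong)
        fix n assume "n \<in> {..<N}"
        then have "n < N" by simp
        have "\<rho> ^ (2 * n) = \<rho> ^ n * \<rho> ^ n" by (metis power_add mult_2)
        from delta[OF \<open>n < N\<close>, of "\<lambda>m. a n * cnj (b m) * of_real (\<rho> ^ n * \<rho> ^ m)" "of_real (2 * pi)"]
        show "(\<Sum>m<N. a n * cnj (b m) * of_real (\<rho> ^ n * \<rho> ^ m) * (if n = m then of_real (2 * pi) else 0))
            = of_real (2 * pi) * h n"
          unfolding h_def \<open>\<rho> ^ (2 * n) = \<rho> ^ n * \<rho> ^ n\<close> by (rule trans) (rule mult.commute)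
      qed simp
    qed
    ultimately show ?thesis by (intro has_integral_unique[OF IJ(1)]) (simp only:)
  qed
  have "(\<lambda>N. I N / of_real (2 * pi)) \<longlonglongrightarrow> J / of_real (2 * pi)"
    by (intro tendsto_intros IJ) auto
  then have sums: "h sums (J / of_real (2 * pi))" by (simp add: I sums_def)
  then show "summable (\<lambda>n. a n * cnj (b n) * of_real (\<rho> ^ (2 * n)))"
    using sums_summable by (auto simp: h_def[abs_def])
  have "J = of_real (2 * pi) * (\<Sum>n. h n)" using sums_unique[OF sums, symmetric] by simp
  then show "((\<lambda>t. synth c R a (c + rcis (\<rho> * R) t) * cnj (synth c R b (c + rcis (\<rho> * R) t))) has_integral
      of_real (2 * pi) * (\<Sum>n. a n * cnj (b n) * of_real (\<rho> ^ (2 * n)))) {0..2 * pi}"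
    using IJ(2) by (simp add: synth h_def[abs_def])
qed

lemma parseval_circle_norm:
  assumes R: "R > 0" and a: "powser_conv a" and \<rho>: "0 \<le> \<rho>" "\<rho> < 1"
  shows "summable (\<lambda>n. (cmod (a n))\<^sup>2 * \<rho> ^ (2 * n))"
    and "((\<lambda>t. (cmod (synth c R a (c + rcis (\<rho> * R) t)))\<^sup>2) has_integral
      2 * pi * (\<Sum>n. (cmod (a n))\<^sup>2 * \<rho> ^ (2 * n))) {0..2 * pi}"
proof -
  have h: "a n * cnj (a n) * of_real (\<rho> ^ (2 * n)) = of_real ((cmod (a n))\<^sup>2 * \<rho> ^ (2 * n))" for n
    by (simp only: complex_norm_square[symmetric] of_real_mult)
  note p = parseval_circle[OF R a a \<rho>, unfolded h]
  have s: "summable (\<lambda>n. (cmod (a n))\<^sup>2 * \<rho> ^ (2 * n))"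
    using p(1) by (simp only: summable_of_real_iff)
  then show "summable (\<lambda>n. (cmod (a n))\<^sup>2 * \<rho> ^ (2 * n))" .
  have "((\<lambda>t. Re (synth c R a (c + rcis (\<rho> * R) t) * cnj (synth c R a (c + rcis (\<rho> * R) t)))) has_integral
      Re (of_real (2 * pi) * (\<Sum>n. complex_of_real ((cmod (a n))\<^sup>2 * \<rho> ^ (2 * n))))) {0..2 * pi}"
    using has_integral_linear[OF p(2) bounded_linear_Re] by (simp add: o_def)
  moreover have "Re (z * cnj z) = (cmod z)\<^sup>2" for z
    by (simp add: complex_norm_square[symmetric] del: of_real_power)
  ultimately show "((\<lambda>t. (cmod (synth c R a (c + rcis (\<rho> * R) t)))\<^sup>2) has_integral
      2 * pi * (\<Sum>n. (cmod (a n))\<^sup>2 * \<rho> ^ (2 * n))) {0..2 * pi}"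
    using suminf_of_real[OF s, where 'a = complex, symmetric]
    by (simp only: of_real_mult[symmetric] Re_complex_of_real)
qed

lemma holomorphic_eq_synth:
  assumes R: "R > 0" and f: "f holomorphic_on ball c R" "\<And>z. z \<notin> ball c R \<Longrightarrow> f z = 0"
  obtains a where "powser_conv a" "f = synth c R a"
proof
  define a where "a n = (deriv ^^ n) f c / fact n * of_real R ^ n" for n
  have s: "(\<lambda>n. a n * ((z - c) / of_real R) ^ n) sums f z" if "z \<in> ball c R" for z
  proof -
    have "a n * ((z - c) / of_real R) ^ n = (deriv ^^ n) f c / fact n * (z - c) ^ n" for n
      using R by (simp add: a_def power_divide)
    then show ?thesis using holomorphic_power_series[OF f(1) that] by simp
  qed
  show "powser_conv a" unfolding powser_conv_def
  proof (intro allI impI)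
    fix \<rho> :: real assume \<rho>: "0 \<le> \<rho>" "\<rho> < 1"
    \<comment> \<open>Convergence of the Taylor series is known pointwise only; convergence at the
      larger radius \<sigma> forces absolute convergence at \<rho>.\<close>
    then obtain \<sigma> where \<sigma>: "\<rho> < \<sigma>" "\<sigma> < 1" using dense by blast
    have "c + of_real (\<sigma> * R) \<in> ball c R" using R \<rho> \<sigma> by (simp add: dist_norm norm_mult)
    from sums_summable[OF s[OF this]] have "summable (\<lambda>n. a n * of_real \<sigma> ^ n)"
      using R by simp
    then have "summable (\<lambda>n. norm (a n * (of_real \<rho> :: complex) ^ n))"
      by (rule powser_insidea) (use \<rho> \<sigma> in simp)
    then show "summable (\<lambda>n. cmod (a n) * \<rho> ^ n)" using \<rho> by (simp add: norm_mult norm_power)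
  qed
  show "f = synth c R a"
  proof
    fix z show "f z = synth c R a z"
      using sums_unique[OF s[of z]] f(2)[of z] by (auto simp: synth_def disk_fun_def)
  qed
qed

lemma synth_holomorphic:
  assumes R: "R > 0" and a: "powser_conv a"
  shows "synth c R a holomorphic_on ball c R"
proof -
  have "(\<lambda>z. \<Sum>n. a n * ((z - c) / of_real R) ^ n) holomorphic_on ball c R"
  proof (rule power_series_holomorphic)
    fix z assume z: "z \<in> ball c R"
    then have "cmod ((z - c) / of_real R) < 1"
      using R by (simp add: norm_divide dist_norm norm_minus_commute)
    from summable_sums[OF powser_conv_summable[OF a this]]
    show "(\<lambda>n. a n / of_real R ^ n * (z - c) ^ n) sums (\<Sum>n. a n * ((z - c) / of_real R) ^ n)"
      by (simp add: power_divide)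
  qed
  then show ?thesis
    by (rule holomorphic_transform) (simp add: synth_def disk_fun_def)
qed

text \<open>Parseval turns the circle means into sums of |a_n|^2 \<rho> ^ (2 n). If the means are
  bounded, each finite partial sum is bounded uniformly in \<rho>, and \<rho> may tend to 1 there;
  conversely every factor \<rho> ^ (2 n) is at most 1.\<close>

lemma hardy_space_eq:
  assumes R: "R > 0"
  shows "hardy_space c R = synth c R ` l2"
proof (intro equalityI subsetI)
  fix f assume "f \<in> hardy_space c R"
  then have f: "f holomorphic_on ball c R" "\<And>z. z \<notin> ball c R \<Longrightarrow> f z = 0"
    "bdd_above ((\<lambda>r. integral {0..2 * pi} (\<lambda>t. (cmod (f (c + rcis r t)))\<^sup>2)) ` {0<..<R})"
    by (auto simp: hardy_space_def)
  obtain a where a: "powser_conv a" "f = synth c R a"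
    using holomorphic_eq_synth[OF R f(1,2)] by blast
  obtain B where B: "\<And>r. 0 < r \<Longrightarrow> r < R \<Longrightarrow> integral {0..2 * pi} (\<lambda>t. (cmod (f (c + rcis r t)))\<^sup>2) \<le> B"
    using f(3) unfolding bdd_above_def by (metis greaterThanLessThan_iff imageI)
  have le: "(\<Sum>n<N. (cmod (a n))\<^sup>2 * \<rho> ^ (2 * n)) \<le> B / (2 * pi)" if \<rho>: "0 < \<rho>" "\<rho> < 1" for \<rho> N
  proof -
    note p = parseval_circle_norm[OF R a(1), of \<rho>]
    have "2 * pi * (\<Sum>n. (cmod (a n))\<^sup>2 * \<rho> ^ (2 * n)) \<le> B"
      using integral_unique[OF p(2)[of c]] B[of "\<rho> * R"] \<rho> R by (simp add: a)
    then have "(\<Sum>n. (cmod (a n))\<^sup>2 * \<rho> ^ (2 * n)) \<le> B / (2 * pi)"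
      by (simp add: field_simps)
    moreover have "(\<Sum>n<N. (cmod (a n))\<^sup>2 * \<rho> ^ (2 * n)) \<le> (\<Sum>n. (cmod (a n))\<^sup>2 * \<rho> ^ (2 * n))"
      by (rule sum_le_suminf) (use p(1) \<rho> in auto)
    ultimately show ?thesis by linarith
  qed
  have "summable (\<lambda>n. (cmod (a n))\<^sup>2)"
  proof (rule summableI_nonneg_bounded)
    fix N
    have "((\<lambda>\<rho>. \<Sum>n<N. (cmod (a n))\<^sup>2 * \<rho> ^ (2 * n)) \<longlongrightarrow> (\<Sum>n<N. (cmod (a n))\<^sup>2 * 1 ^ (2 * n))) (at_left 1)"
      by (intro tendsto_intros)
    moreover have "eventually (\<lambda>\<rho>. \<rho> \<in> {0<..<1}) (at_left (1::real))"
      by (rule eventually_at_left_real) simp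
    then have "eventually (\<lambda>\<rho>. (\<Sum>n<N. (cmod (a n))\<^sup>2 * \<rho> ^ (2 * n)) \<le> B / (2 * pi)) (at_left 1)"
      by eventually_elim (use le in auto)
    ultimately show "(\<Sum>n<N. (cmod (a n))\<^sup>2) \<le> B / (2 * pi)"
      using tendsto_upperbound[of _ _ "at_left (1::real)"] by fastforce
  qed auto
  then show "f \<in> synth c R ` l2" using a by (auto simp: l2_def)
next
  fix f assume "f \<in> synth c R ` l2"
  then obtain a where a: "a \<in> l2" "f = synth c R a" by auto
  have "integral {0..2 * pi} (\<lambda>t. (cmod (f (c + rcis r t)))\<^sup>2) \<le> 2 * pi * (\<Sum>n. (cmod (a n))\<^sup>2)"
    if r: "r \<in> {0<..<R}" for r
  proof -
    define \<rho> where "\<rho> = r / R"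
    have \<rho>: "0 \<le> \<rho>" "\<rho> < 1" "r = \<rho> * R" using r R by (auto simp: \<rho>_def)
    note p = parseval_circle_norm[OF R powser_conv_l2[OF a(1)] \<rho>(1,2)]
    have "integral {0..2 * pi} (\<lambda>t. (cmod (f (c + rcis r t)))\<^sup>2) = 2 * pi * (\<Sum>n. (cmod (a n))\<^sup>2 * \<rho> ^ (2 * n))"
      using integral_unique[OF p(2)] by (simp add: a \<rho>)
    also have "\<dots> \<le> 2 * pi * (\<Sum>n. (cmod (a n))\<^sup>2)"
    proof (rule mult_left_mono, rule suminf_le)
      show "(cmod (a n))\<^sup>2 * \<rho> ^ (2 * n) \<le> (cmod (a n))\<^sup>2" for n
        using \<rho> by (intro mult_left_le power_le_one) auto
    qed (use p(1) a in \<open>auto simp: l2_def\<close>)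
    finally show ?thesis .
  qed
  then have "bdd_above ((\<lambda>r. integral {0..2 * pi} (\<lambda>t. (cmod (f (c + rcis r t)))\<^sup>2)) ` {0<..<R})"
    by (rule bdd_aboveI2)
  moreover have "\<forall>z. z \<notin> ball c R \<longrightarrow> f z = 0" by (simp add: a synth_def disk_fun_def)
  ultimately show "f \<in> hardy_space c R"
    using synth_holomorphic[OF R powser_conv_l2[OF a(1)]] by (simp add: hardy_space_def a)
qed

lemma l2_prod_summable:
  assumes "a \<in> l2" "b \<in> l2"
  shows "summable (\<lambda>n. cmod (a n) * cmod (b n))"
proof (rule summable_comparison_test)
  show "summable (\<lambda>n. (cmod (a n))\<^sup>2 + (cmod (b n))\<^sup>2)"
    using assms by (intro summable_add) (auto simp: l2_def)
  have "x * y \<le> x\<^sup>2 + y\<^sup>2" if "0 \<le> x" "0 \<le> y" for x y :: real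
  proof -
    have "2 * (x * y) \<le> x\<^sup>2 + y\<^sup>2" using zero_le_power2[of "x - y"] by (simp add: power2_diff)
    then show ?thesis using mult_nonneg_nonneg[OF that] by linarith
  qed
  then show "\<exists>N. \<forall>n\<ge>N. norm (cmod (a n) * cmod (b n)) \<le> (cmod (a n))\<^sup>2 + (cmod (b n))\<^sup>2" by simp
qed

text \<open>As functions of the radius the Parseval series are dominated by |a_n| |b_n|, hence
  converge uniformly on the closed interval up to R. The limit of the circle means is therefore the
  value of the series at R.\<close>

lemma hardy_inner_synth:
  assumes R: "R > 0" and a: "a \<in> l2" and b: "b \<in> l2"
  shows "hardy_inner c R (synth c R a) (synth c R b) = (\<Sum>n. a n * cnj (b n))"
proof -
  define g where "g r = (\<Sum>n. a n * cnj (b n) * of_real ((r / R) ^ (2 * n)))" for r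
  have "uniform_limit {0..R} (\<lambda>N r. \<Sum>n<N. a n * cnj (b n) * of_real ((r / R) ^ (2 * n))) g sequentially"
    unfolding g_def
  proof (rule Weierstrass_m_test)
    show "summable (\<lambda>n. cmod (a n) * cmod (b n))" by (rule l2_prod_summable[OF a b])
    fix n r assume r: "r \<in> {0..R}"
    have "(r / R) ^ (2 * n) \<le> 1" using r R by (intro power_le_one) auto
    moreover have "0 \<le> (r / R) ^ (2 * n)" by (simp add: power_mult)
    ultimately show "norm (a n * cnj (b n) * of_real ((r / R) ^ (2 * n))) \<le> cmod (a n) * cmod (b n)"
      unfolding norm_mult norm_of_real complex_mod_cnj abs_of_nonneg[OF \<open>0 \<le> (r / R) ^ (2 * n)\<close>]
      by (intro mult_left_le) auto
  qed
  then have "continuous_on {0..R} g"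
    by (rule uniform_limit_theorem[rotated]) (auto intro!: always_eventually continuous_intros simp: R less_imp_neq[OF R, symmetric])
  then have "(g \<longlongrightarrow> g R) (at_left R)" using R by (rule continuous_on_Icc_at_leftD)
  moreover have "eventually (\<lambda>r. r \<in> {0<..<R}) (at_left R)"
    by (rule eventually_at_left_real[OF R])
  then have "eventually (\<lambda>r. g r = circle_mean c (\<lambda>z. synth c R a z * cnj (synth c R b z)) r) (at_left R)"
  proof eventually_elim
    case (elim r)
    note p = parseval_circle(2)[OF R powser_conv_l2[OF a] powser_conv_l2[OF b], of "r / R" c]
    show ?case using integral_unique[OF p] elim R by (simp add: circle_mean_def g_def)
  qed
  ultimately have "(circle_mean c (\<lambda>z. synth c R a z * cnj (synth c R b z)) \<longlongrightarrow> g R) (at_left R)"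
    by (rule Lim_transform_eventually)
  then have "hardy_inner c R (synth c R a) (synth c R b) = g R"
    unfolding hardy_inner_def by (intro tendsto_Lim) auto
  then show ?thesis using R by (simp add: g_def)
qed

lemma ip_norm_synth:
  assumes "R > 0" "a \<in> l2"
  shows "ip_norm (hardy_inner c R) (synth c R a) = l2norm a"
proof -
  have "(\<lambda>n. a n * cnj (a n)) = (\<lambda>n. of_real ((cmod (a n))\<^sup>2))"
    by (simp only: complex_norm_square[symmetric])
  then show ?thesis using assms suminf_of_real[of "\<lambda>n. (cmod (a n))\<^sup>2", where 'a = complex, symmetric]
    by (simp add: ip_norm_def hardy_inner_synth l2norm_def l2_def del: of_real_power)
qed

lemma synth_lin:
  assumes R: "R > 0" and a: "a \<in> l2" and b: "b \<in> l2"
  shows "synth c R (\<lambda>n. x * a n + y * b n) = (\<lambda>z. x * synth c R a z + y * synth c R b z)"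
proof
  fix z
  show "synth c R (\<lambda>n. x * a n + y * b n) z = x * synth c R a z + y * synth c R b z"
  proof (cases "z \<in> ball c R")
    case True
    then have "cmod ((z - c) / of_real R) < 1"
      using R by (simp add: norm_divide dist_norm norm_minus_commute)
    then have "summable (\<lambda>n. a n * ((z - c) / of_real R) ^ n)" "summable (\<lambda>n. b n * ((z - c) / of_real R) ^ n)"
      using powser_conv_summable powser_conv_l2 a b by blast+
    then show ?thesis using True
      by (simp add: synth_def disk_fun_def distrib_right mult.assoc suminf_add[symmetric] suminf_mult summable_mult)
  qed (simp add: synth_def disk_fun_def)
qed

text \<open>Injectivity comes from the isometry \<open>ip_norm_synth\<close>: a difference that
  synthesizes to 0 has l2 norm 0.\<close>

lemma synth_inj:
  assumes R: "R > 0"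
  shows "inj_on (synth c R) l2"
proof
  fix a b assume ab: "a \<in> l2" "b \<in> l2" "synth c R a = synth c R b"
  define d where "d n = 1 * a n + (-1) * b n" for n
  have d: "d \<in> l2" unfolding d_def by (rule l2_lin[OF ab(1,2)])
  have "synth c R d = (\<lambda>z. 0)" unfolding d_def synth_lin[OF R ab(1,2)] by (simp add: ab(3))
  also have "\<dots> = synth c R (\<lambda>n. 0)" by (simp add: synth_def disk_fun_def fun_eq_iff)
  finally have "l2norm d = l2norm (\<lambda>n. 0)"
    using ip_norm_synth[OF R d, of c] ip_norm_synth[OF R, of "\<lambda>n. 0" c] by (simp add: l2_def)
  then have "l2norm d = 0" by (simp add: l2norm_def)
  then have "d n = 0" for n using l2_bounded[OF d, of n] by simp
  then show "a = b" by (simp add: d_def fun_eq_iff)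
qed

definition unit_seq :: "nat \<Rightarrow> nat \<Rightarrow> complex" where
  "unit_seq m n = (if n = m then 1 else 0)"

lemma l2_finite_support: "finite {n. a n \<noteq> 0} \<Longrightarrow> a \<in> l2"
  unfolding l2_def by (auto intro!: summable_finite[of "{n. a n \<noteq> 0}"])

lemma unit_seq_l2 [simp]: "unit_seq m \<in> l2"
  by (rule l2_finite_support) (simp add: unit_seq_def)

lemma synth_finite_support:
  assumes "finite S" "\<And>n. n \<notin> S \<Longrightarrow> a n = 0"
  shows "synth c R a = disk_fun c R (\<lambda>z. \<Sum>n\<in>S. a n * ((z - c) / of_real R) ^ n)"
  unfolding synth_def by (subst suminf_finite[OF assms(1)]) (auto simp: assms(2))

lemma hardy_monom_eq: "hardy_monom c R m = synth c R (unit_seq m)"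
  by (subst synth_finite_support[of "{m}"]) (auto simp: unit_seq_def hardy_monom_def power_divide)

lemma hardy_monom_orthonormal:
  assumes R: "R > 0"
  shows "orthonormal_basis (hardy_space c R) (hardy_inner c R) (hardy_monom c R)"
  unfolding orthonormal_basis_def
proof (intro conjI allI ballI impI)
  show "hardy_monom c R m \<in> hardy_space c R" for m
    by (simp add: hardy_space_eq[OF R] hardy_monom_eq)
  show "hardy_inner c R (hardy_monom c R m) (hardy_monom c R n) = (if m = n then 1 else 0)" for m n
  proof -
    have "(\<Sum>k. unit_seq m k * cnj (unit_seq n k)) = (\<Sum>k\<in>{m}. unit_seq m k * cnj (unit_seq n k))"
      by (rule suminf_finite) (auto simp: unit_seq_def)
    then show ?thesis by (simp add: hardy_monom_eq hardy_inner_synth[OF R]) (simp add: unit_seq_def)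
  qed
  fix f and \<epsilon> :: real assume f: "f \<in> hardy_space c R" and \<epsilon>: "\<epsilon> > 0"
  obtain a where a: "a \<in> l2" "f = synth c R a" using f by (auto simp: hardy_space_eq[OF R])
  have s: "summable (\<lambda>n. (cmod (a n))\<^sup>2)" using a by (simp add: l2_def)
  have "\<forall>\<^sub>F N in sequentially. (\<Sum>n. (cmod (a n))\<^sup>2) - \<epsilon>\<^sup>2 < (\<Sum>n<N. (cmod (a n))\<^sup>2)"
    using summable_LIMSEQ[OF s] by (rule order_tendstoD) (use \<epsilon> in simp)
  then obtain N where N: "(\<Sum>n. (cmod (a n))\<^sup>2) - (\<Sum>n<N. (cmod (a n))\<^sup>2) < \<epsilon>\<^sup>2"
    unfolding eventually_sequentially by (metis diff_less_eq less_diff_eq add.commute order_refl)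
  \<comment> \<open>h is the truncation of the coefficients and d the remaining tail; the squared
    norm of d is the remainder of the series of |a_n|^2.\<close>
  define h where "h n = (if n < N then a n else 0)" for n
  define d where "d n = 1 * a n + (-1) * h n" for n
  have h: "h \<in> l2" by (rule l2_finite_support) (simp add: h_def)
  have d: "d \<in> l2" unfolding d_def by (rule l2_lin[OF a(1) h])
  have "(\<lambda>n. (cmod (d n))\<^sup>2) = (\<lambda>n. (cmod (a n))\<^sup>2 - (cmod (h n))\<^sup>2)"
    by (auto simp: d_def h_def)
  moreover have "(\<lambda>n. (cmod (h n))\<^sup>2) sums (\<Sum>n<N. (cmod (h n))\<^sup>2)"
    by (rule sums_finite) (auto simp: h_def)
  ultimately have "(\<Sum>n. (cmod (d n))\<^sup>2) = (\<Sum>n. (cmod (a n))\<^sup>2) - (\<Sum>n<N. (cmod (a n))\<^sup>2)"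
    using suminf_diff[OF s, of "\<lambda>n. (cmod (h n))\<^sup>2"] by (simp add: sums_iff) (simp add: h_def)
  then have "l2norm d < \<epsilon>" using N \<epsilon> by (simp add: l2norm_def real_less_lsqrt)
  moreover have "synth c R d = (\<lambda>z. f z - (\<Sum>n<N. a n * hardy_monom c R n z))"
  proof -
    have "synth c R h z = (\<Sum>n<N. a n * hardy_monom c R n z)" for z
      by (subst synth_finite_support[of "{..<N}"])
        (auto simp: h_def hardy_monom_def disk_fun_def power_divide)
    then show ?thesis unfolding d_def synth_lin[OF R a(1) h] by (simp add: a)
  qed
  ultimately show "\<exists>N a. ip_norm (hardy_inner c R) (\<lambda>z. f z - (\<Sum>n<N. a n * hardy_monom c R n z)) < \<epsilon>"
    using ip_norm_synth[OF R d, of c] by metis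
qed

section \<open>Transport of matrices to operators on the Hardy space\<close>

definition hardy_op :: "complex \<Rightarrow> real \<Rightarrow> (nat \<Rightarrow> nat \<Rightarrow> complex) \<Rightarrow> (complex \<Rightarrow> complex) \<Rightarrow> complex \<Rightarrow> complex" where
  "hardy_op c R N f = synth c R (unit_op N (inv_into l2 (synth c R) f))"

lemma hardy_op_synth: "R > 0 \<Longrightarrow> a \<in> l2 \<Longrightarrow> hardy_op c R N (synth c R a) = synth c R (unit_op N a)"
  by (simp add: hardy_op_def inv_into_f_f[OF synth_inj])

lemma hardy_op_bounded:
  assumes R: "R > 0" and N: "abs_mat N"
  shows "bounded_operator (hardy_space c R) (hardy_inner c R) (hardy_op c R N)"
proof -
  obtain C where C: "\<And>a. a \<in> l2 \<Longrightarrow> unit_op N a \<in> l2" "\<And>a. a \<in> l2 \<Longrightarrow> l2norm (unit_op N a) \<le> C * l2norm a"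
    using unit_op_l2[OF N] by blast
  show ?thesis unfolding bounded_operator_def hardy_space_eq[OF R]
  proof (intro conjI ballI allI exI[of _ C])
    fix f assume "f \<in> synth c R ` l2"
    then obtain a where a: "a \<in> l2" "f = synth c R a" by auto
    show "hardy_op c R N f \<in> synth c R ` l2" using a C by (simp add: hardy_op_synth[OF R])
    show "ip_norm (hardy_inner c R) (hardy_op c R N f) \<le> C * ip_norm (hardy_inner c R) f"
      using a C by (simp add: hardy_op_synth[OF R] ip_norm_synth[OF R])
    fix g \<alpha> \<beta> assume "g \<in> synth c R ` l2"
    then obtain b where b: "b \<in> l2" "g = synth c R b" by auto
    have "unit_op N (\<lambda>n. \<alpha> * a n + \<beta> * b n) = (\<lambda>n. \<alpha> * unit_op N a n + \<beta> * unit_op N b n)"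
      by (intro ext) (rule unit_op_linear[OF N l2_bounded[OF a(1)] l2_bounded[OF b(1)]])
    then show "hardy_op c R N (\<lambda>z. \<alpha> * f z + \<beta> * g z) =
        (\<lambda>z. \<alpha> * hardy_op c R N f z + \<beta> * hardy_op c R N g z)"
      using a b C synth_lin[OF R a(1) b(1), of c \<alpha> \<beta>] synth_lin[OF R C(1)[OF a(1)] C(1)[OF b(1)], of c \<alpha> \<beta>]
        hardy_op_synth[OF R l2_lin[OF a(1) b(1)], of c N \<alpha> \<beta>]
      by (simp add: hardy_op_synth[OF R])
  qed
qed

text \<open>The right inverse of a unitriangular matrix has itself a right inverse, so it is two-sided.\<close>

lemma hardy_op_invertible:
  assumes R: "R > 0" and N: "strict_tri N"
  shows "invertible_operator (hardy_space c R) (hardy_inner c R) (hardy_op c R N)"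
proof -
  obtain W where W: "strict_tri W" "\<And>a B. (\<And>m. cmod (a m) \<le> B) \<Longrightarrow> unit_op N (unit_op W a) = a"
    using strict_tri_right_inverse[OF N] by blast
  obtain V where V: "strict_tri V" "\<And>a B. (\<And>m. cmod (a m) \<le> B) \<Longrightarrow> unit_op W (unit_op V a) = a"
    using strict_tri_right_inverse[OF W(1)] by blast
  have NW: "unit_op N (unit_op W a) = a" if "a \<in> l2" for a using W(2)[OF l2_bounded[OF that]] .
  have mem: "unit_op A a \<in> l2" if "strict_tri A" "a \<in> l2" for A a
    using unit_op_l2[OF strict_tri_abs_mat[OF that(1)]] that(2) by blast
  have WN: "unit_op W (unit_op N a) = a" if a: "a \<in> l2" for a
  proof -
    have WV: "unit_op W (unit_op V a) = a" using V(2)[OF l2_bounded[OF a]] .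
    \<comment> \<open>Write a as W (V a); then N W = 1 applied to V a removes the two outer
      operators.\<close>
    have "unit_op N a = unit_op V a" using NW[OF mem[OF V(1) a]] WV by simp
    then show ?thesis using WV by simp
  qed
  show ?thesis unfolding invertible_operator_def
  proof (intro conjI exI[of _ "hardy_op c R W"] ballI)
    fix f assume "f \<in> hardy_space c R"
    then obtain a where a: "a \<in> l2" "f = synth c R a" by (auto simp: hardy_space_eq[OF R])
    show "hardy_op c R W (hardy_op c R N f) = f" "hardy_op c R N (hardy_op c R W f) = f"
      using a mem[OF N] mem[OF W(1)] by (simp_all add: hardy_op_synth[OF R] NW WN)
  qed (intro hardy_op_bounded[OF R] strict_tri_abs_mat N W)+
qed

text \<open>1 + N sends the unit sequence m to its column m, so the synthesized columns are the
  images of the monomials under the transported operator.\<close>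

lemma riesz_basis_of_strict_tri:
  assumes R: "R > 0" and N: "strict_tri N"
    and v: "\<And>m. v m = synth c R (\<lambda>k. unit_seq m k + N k m)"
  shows "riesz_basis (hardy_space c R) (hardy_inner c R) v"
  unfolding riesz_basis_def
proof (intro exI conjI allI)
  show "orthonormal_basis (hardy_space c R) (hardy_inner c R) (hardy_monom c R)"
    by (rule hardy_monom_orthonormal[OF R])
  show "invertible_operator (hardy_space c R) (hardy_inner c R) (hardy_op c R N)"
    by (rule hardy_op_invertible[OF R N])
  fix m
  have "(\<Sum>\<^sub>\<infinity>j. N k j * unit_seq m j) = N k m" for k
    by (rule infsumI, rule has_sum_finite_neutralI[of "{m}"]) (auto simp: unit_seq_def)
  then show "v m = hardy_op c R N (hardy_monom c R m)"
    by (simp add: v hardy_monom_eq hardy_op_synth[OF R] unit_op_def[abs_def])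
qed

section \<open>Return words\<close>

definition occ_set :: "nat list \<Rightarrow> nat list \<Rightarrow> nat set" where
  "occ_set w g = {i. i + length w \<le> length g \<and> take (length w) (drop i g) = w}"

lemma occ_card: "occ w g = card (occ_set w g)"
  by (simp add: occ_def occ_set_def)

lemma finite_occ_set [simp]: "finite (occ_set w g)"
  by (rule finite_subset[of _ "{..length g}"]) (auto simp: occ_set_def)

lemma occ_set_append: "i + length w \<le> length x \<Longrightarrow> i \<in> occ_set w (x @ y) \<longleftrightarrow> i \<in> occ_set w x"
  by (auto simp: occ_set_def)

lemma occ_append_mono: "occ w x \<le> occ w (x @ y)"
proof -
  have "occ_set w x \<subseteq> occ_set w (x @ y)" by (auto simp: occ_set_def)
  then show ?thesis unfolding occ_card by (rule card_mono[OF finite_occ_set])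
qed

text \<open>An occurrence that is not already present must end at the new last letter, and this
  fixes its position.\<close>

lemma occ_snoc: "occ w (x @ [a]) \<le> Suc (occ w x)"
proof -
  have "occ_set w (x @ [a]) \<subseteq> insert (Suc (length x) - length w) (occ_set w x)"
  proof
    fix i assume i: "i \<in> occ_set w (x @ [a])"
    then have "i + length w \<le> Suc (length x)" by (simp add: occ_set_def)
    then consider "i + length w \<le> length x" | "i + length w = Suc (length x)" by linarith
    then show "i \<in> insert (Suc (length x) - length w) (occ_set w x)"
      by cases (use i occ_set_append in auto)
  qed
  then have "card (occ_set w (x @ [a])) \<le> card (insert (Suc (length x) - length w) (occ_set w x))"
    by (intro card_mono) auto
  then show ?thesis unfolding occ_card by (rule order_trans) (rule card_insert_le_m1, auto)
qed

lemma zero_occ: "0 \<in> occ_set w (w @ g)"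
  by (simp add: occ_set_def)

lemma occ_pos: "occ w (w @ g) \<ge> 1"
  unfolding occ_card using zero_occ[of w g] by (metis One_nat_def Suc_leI card_gt_0_iff empty_iff finite_occ_set)

lemma occ_plus_Nil: "occ_plus w [] = 0"
proof -
  have "occ_set w w = {0}" by (auto simp: occ_set_def)
  then show ?thesis by (simp add: occ_plus_def occ_card)
qed

section \<open>Values of words in base b\<close>

lemma word_int_Nil [simp]: "word_int b [] = 0"
  by (simp add: word_int_def)

lemma word_int_Cons: "word_int b (x # g) = x * b ^ length g + word_int b g"
  by (simp add: word_int_def sum.lessThan_Suc_shift del: sum.lessThan_Suc)

lemma word_int_append: "word_int b (h @ g) = word_int b h * b ^ length g + word_int b g"
  by (induction h) (auto simp: word_int_Cons power_add algebra_simps)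

lemma word_real_append:
  assumes "b > 0"
  shows "word_real b (h @ g) = word_real b h + word_real b g / real b ^ length h"
  using assms by (simp add: word_real_def word_int_append power_add field_simps)

lemma word_int_less:
  assumes "h \<in> words b" "b > 0"
  shows "word_int b h < b ^ length h"
  using assms(1)
proof (induction h)
  case (Cons x h)
  have x: "x + 1 \<le> b" and h: "h \<in> words b" using Cons.prems by (auto simp: words_def)
  have "word_int b (x # h) < x * b ^ length h + b ^ length h"
    using Cons.IH[OF h] by (simp add: word_int_Cons)
  also have "\<dots> = (x + 1) * b ^ length h" by simp
  also have "\<dots> \<le> b * b ^ length h" using x by (rule mult_le_mono1)
  finally show ?case by simp
qed simp

text \<open>The upper bound leaves room for the cell length b ^ (- |h|): the affine map of h sends
  [0, 1] into itself. \<open>offset_bound\<close> depends on this sharp form.\<close>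

lemma word_real_bounds:
  assumes "h \<in> words b" "b > 0"
  shows "0 \<le> word_real b h" "word_real b h \<le> 1 - 1 / real b ^ length h"
proof -
  show "0 \<le> word_real b h" by (simp add: word_real_def)
  have "word_int b h + 1 \<le> b ^ length h" using word_int_less[OF assms] by simp
  then have "real (word_int b h) + 1 \<le> real b ^ length h"
    by (metis of_nat_1 of_nat_add of_nat_le_iff of_nat_power)
  then show "word_real b h \<le> 1 - 1 / real b ^ length h"
    using assms(2) by (simp add: word_real_def field_simps)
qed

section \<open>Structure of return words and the point x_w\<close>

locale pattern =
  fixes b :: nat and w :: "nat list"
  assumes b: "b > 1" and w: "w \<in> words b" and w_nonempty: "w \<noteq> []"
begin

abbreviation G :: "nat list set" where "G \<equiv> return_words b w"
abbreviation gw :: "nat list" where "gw \<equiv> shortest_word b w"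
abbreviation p :: nat where "p \<equiv> length gw"
abbreviation X :: real where "X \<equiv> x_pt b w"
text \<open>The displacement of x_w under the affine map of g.\<close>

definition offset :: "nat list \<Rightarrow> real" where
  "offset g = word_real b g + X / real b ^ length g - X"

text \<open>The last digit of g raises the number of occurrences, and an occurrence absent before
  that digit must end at the end of w @ g, hence start at position |g|.\<close>

lemma return_word_suffix:
  assumes "g \<in> G"
  shows "drop (length g) (w @ g) = w"
proof -
  have g: "g \<noteq> []" "occ_plus w g = 1" "occ_plus w (butlast g) = 0"
    using assms by (auto simp: return_words_def)
  have "occ w (w @ g) > occ w (w @ butlast g)" using g(2,3) unfolding occ_plus_def by linarith
  then have "\<not> occ_set w (w @ g) \<subseteq> occ_set w (w @ butlast g)"
    unfolding occ_card using card_mono[of "occ_set w (w @ butlast g)" "occ_set w (w @ g)"] by auto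
  then obtain i where i: "i \<in> occ_set w (w @ g)" "i \<notin> occ_set w (w @ butlast g)" by auto
  have "w @ g = (w @ butlast g) @ [last g]" using g(1) by simp
  then have "\<not> i + length w \<le> length (w @ butlast g)" using i occ_set_append by metis
  moreover have "i + length w \<le> length (w @ g)" using i by (simp add: occ_set_def)
  moreover have "length g > 0" using g(1) by simp
  ultimately have "i = length g" by simp
  then show ?thesis using i(1) by (simp add: occ_set_def)
qed

text \<open>Take the shortest prefix that produces an occurrence besides the initial one. One more
  letter creates at most one occurrence, so there the count passes from 0 to exactly 1. The word u
  itself qualifies, having occurrences at 0 and at |u|.\<close>

lemma return_word_prefix_exists:
  assumes u: "u \<in> words b" "u \<noteq> []" and suf: "drop (length u) (w @ u) = w"
  obtains n where "n \<le> length u" "take n u \<in> G"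
proof -
  define P where "P n \<longleftrightarrow> n \<le> length u \<and> occ_plus w (take n u) \<ge> 1" for n
  have "{0, length u} \<subseteq> occ_set w (w @ u)"
    using zero_occ suf by (auto simp: occ_set_def)
  then have "card {0, length u} \<le> occ w (w @ u)" unfolding occ_card by (intro card_mono) auto
  then have "P (length u)" using u(2) by (simp add: P_def occ_plus_def)
  define n where "n = (LEAST n. P n)"
  have n: "P n" "\<And>m. m < n \<Longrightarrow> \<not> P m"
    unfolding n_def using LeastI[of P, OF \<open>P (length u)\<close>] not_less_Least by auto
  have "n \<noteq> 0" using n(1) occ_plus_Nil by (cases n) (auto simp: P_def)
  then obtain k where k: "n = Suc k" by (cases n) auto
  have kl: "k < length u" using n(1) by (simp add: P_def k)
  have take: "take n u = take k u @ [u ! k]" by (simp add: k take_Suc_conv_app_nth[OF kl])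
  have k0: "occ_plus w (take k u) = 0" using n(2)[of k] kl by (simp add: k P_def)
  have "occ w (w @ take k u) = 1" using k0 occ_pos[of w "take k u"] by (simp add: occ_plus_def)
  then have "occ w (w @ take n u) \<le> 2" using occ_snoc[of w "w @ take k u" "u ! k"] by (simp add: take)
  then have "occ_plus w (take n u) = 1" using n(1) unfolding P_def occ_plus_def by linarith
  moreover have "take n u \<in> words b" using u(1) by (auto simp: words_def dest: in_set_takeD)
  ultimately have "take n u \<in> G" using k0 by (simp add: return_words_def take)
  then show ?thesis using that n(1) P_def by blast
qed

text \<open>w is a suffix of w @ g, and when g is no longer than w this makes g a suffix of w. A
  short return word is thus determined by its length.\<close>

lemma short_return_word:
  assumes "g \<in> G" "length g \<le> length w"
  shows "g = drop (length w - length g) w"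
proof -
  have "w = drop (length g) w @ g" using return_word_suffix[OF assms(1)] assms(2) by simp
  then have "drop (length w - length g) w = drop (length w - length g) (drop (length g) w @ g)" by simp
  then show ?thesis using assms(2) by simp
qed

text \<open>The prefix lemma with u = w yields a return word of length at most |w|. Words of minimal
  length are then suffixes of w of equal length, so the description in
  \<open>shortest_word_def\<close> has a unique solution.\<close>

lemma shortest_word: "gw \<in> G" "\<And>h. h \<in> G \<Longrightarrow> p \<le> length h" and p_le: "p \<le> length w"
proof -
  obtain n where n: "n \<le> length w" "take n w \<in> G"
    using return_word_prefix_exists[OF w w_nonempty] by auto
  obtain g where g: "g \<in> G" "\<And>h. h \<in> G \<Longrightarrow> length g \<le> length h"
    using ex_has_least_nat[of "\<lambda>g. g \<in> G" _ length, OF n(2)] by blast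
  have len: "length g \<le> length w" if "\<And>h. h \<in> G \<Longrightarrow> length g \<le> length h" for g
    using that[OF n(2)] by simp
  have "h = g" if h: "h \<in> G \<and> (\<forall>k\<in>G. length h \<le> length k)" for h
  proof -
    have "length h = length g" using h g by (meson order_antisym)
    then show ?thesis using short_return_word[OF _ len] h g by metis
  qed
  then have "g = gw" unfolding shortest_word_def using g by (intro the_equality[symmetric]) auto
  then show "gw \<in> G" "\<And>h. h \<in> G \<Longrightarrow> p \<le> length h" "p \<le> length w" using g len by auto
qed

lemma p_pos: "p > 0"
  using shortest_word(1) by (simp add: return_words_def)

text \<open>g_w is a suffix of w, and w is a suffix of w @ g. Hence g_w is a suffix of w @ g, and
  being no longer than g it is a suffix of g.\<close>

lemma return_word_factor:
  assumes "g \<in> G"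
  obtains h where "h \<in> words b" "g = h @ gw"
proof
  have le: "p \<le> length g" by (rule shortest_word(2)[OF assms])
  have "gw = drop (length w - p) w" by (rule short_return_word[OF shortest_word(1) p_le])
  also have "\<dots> = drop (length w - p) (drop (length g) (w @ g))"
    by (simp only: return_word_suffix[OF assms])
  also have "\<dots> = drop (length w + (length g - p)) (w @ g)"
    using le p_le by (simp only: drop_drop) (intro arg_cong2[of _ _ _ _ drop]; simp)
  also have "\<dots> = drop (length g - p) g" by simp
  finally have "drop (length g - p) g = gw" by simp
  then show "g = take (length g - p) g @ gw" by (metis append_take_drop_id)
  show "take (length g - p) g \<in> words b"
    using assms by (auto simp: return_words_def words_def dest: in_set_takeD)
qed

lemma return_word_longer:
  assumes "g \<in> G" "g \<noteq> gw"
  shows "length g > p"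
  using return_word_factor[OF assms(1)] assms(2) by (metis append_Nil length_append length_0_conv less_add_same_cancel2 neq0_conv)

text \<open>If u were non-empty, deleting the last digit of g @ u would leave g intact, together
  with the occurrence that g has already produced.\<close>

lemma return_words_prefix_free:
  assumes "g \<in> G" "g @ u \<in> G"
  shows "u = []"
proof (rule ccontr)
  assume u: "u \<noteq> []"
  have "occ w (w @ g) \<le> occ w (w @ butlast (g @ u))"
    using occ_append_mono[of w "w @ g" "butlast u"] u by (simp add: butlast_append)
  moreover have "occ_plus w g = 1" "occ_plus w (butlast (g @ u)) = 0"
    using assms by (auto simp: return_words_def)
  ultimately show False unfolding occ_plus_def by linarith
qed

text \<open>Kraft's inequality: extend all words of F to a common length n. Prefix-freeness makes
  the sets of extensions disjoint, and together they fit among the b ^ n words of that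
  length.\<close>

lemma kraft_finite:
  assumes "finite F" "F \<subseteq> G"
  shows "(\<Sum>g\<in>F. 1 / real b ^ length g) \<le> 1"
proof -
  \<comment> \<open>Inserting 0 keeps the maximum meaningful for empty F.\<close>
  define n where "n = Max (insert 0 (length ` F))"
  have n: "length g \<le> n" if "g \<in> F" for g unfolding n_def using that assms(1) by simp
  define T where "T k = {x. set x \<subseteq> {..<b} \<and> length x = k}" for k
  define E where "E g = (\<lambda>u. g @ u) ` T (n - length g)" for g
  have T: "finite (T k)" "card (T k) = b ^ k" for k
    unfolding T_def using finite_lists_length_eq[of "{..<b}"] card_lists_length_eq[of "{..<b}"] by auto
  have cE: "card (E g) = b ^ (n - length g)" for g
    unfolding E_def by (subst card_image) (auto simp: inj_on_def T)
  have "E g \<subseteq> T n" if "g \<in> F" for g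
  proof -
    have "set g \<subseteq> {..<b}" using that assms(2) by (auto simp: return_words_def words_def)
    then show ?thesis using n[OF that] by (auto simp: E_def T_def)
  qed
  then have "card (\<Union>g\<in>F. E g) \<le> b ^ n"
    unfolding T(2)[symmetric] by (intro card_mono T) auto
  also have "card (\<Union>g\<in>F. E g) = (\<Sum>g\<in>F. card (E g))"
  proof (rule card_UN_disjoint[OF assms(1)])
    show "\<forall>i\<in>F. finite (E i)" by (simp add: E_def T)
    show "\<forall>i\<in>F. \<forall>j\<in>F. i \<noteq> j \<longrightarrow> E i \<inter> E j = {}"
    proof (intro ballI impI, rule ccontr)
      fix g h assume gh: "g \<in> F" "h \<in> F" "g \<noteq> h" "E g \<inter> E h \<noteq> {}"
      then obtain u v where "g @ u = h @ v" by (auto simp: E_def)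
      then obtain t where "g = h @ t \<or> g @ t = h" by (auto simp: append_eq_append_conv2)
      then show False using gh assms(2) return_words_prefix_free by (metis append_Nil2 subsetD)
    qed
  qed
  finally have le: "(\<Sum>g\<in>F. b ^ (n - length g)) \<le> b ^ n" by (simp add: cE)
  have "(\<Sum>g\<in>F. 1 / real b ^ length g) = (\<Sum>g\<in>F. real (b ^ (n - length g)) / real b ^ n)"
  proof (rule sum.cong)
    fix g assume "g \<in> F"
    then have "real b ^ n = real b ^ length g * real b ^ (n - length g)"
      using n[of g] by (simp add: power_add[symmetric])
    then show "1 / real b ^ length g = real (b ^ (n - length g)) / real b ^ n"
      using b by simp
  qed simp
  also have "\<dots> = real (\<Sum>g\<in>F. b ^ (n - length g)) / real b ^ n"
    by (simp add: sum_divide_distrib)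
  also have "\<dots> \<le> 1" using le b by (simp add: of_nat_le_iff[symmetric] del: of_nat_le_iff of_nat_sum)
  finally show ?thesis .
qed

lemma summable_return_words: "(\<lambda>g. 1 / real b ^ length g) summable_on G"
  by (rule nonneg_bdd_above_summable_on)
    (auto intro!: bdd_aboveI2[of _ _ 1] kraft_finite)

lemma kraft: "(\<Sum>\<^sub>\<infinity>g\<in>G. 1 / real b ^ length g) \<le> 1"
  by (rule infsum_le_finite_sums[OF summable_return_words kraft_finite])

text \<open>Digits at most b - 1 compare the series with a geometric series of sum 1. The digits
  have period p, so splitting off the first p terms leaves b ^ (- p) times the whole series: x_w is
  the fixed point of the map of g_w.\<close>

lemma x_pt_props: "0 \<le> X" "X \<le> 1" "X = word_real b gw + X / real b ^ p"
proof -
  define d where "d i = gw ! (i mod p)" for i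
  define f where "f i = real (d i) / real b ^ Suc i" for i
  have X: "X = suminf f" by (simp add: x_pt_def seq_real_def f_def[abs_def] d_def)
  have dl: "d i + 1 \<le> b" for i
  proof -
    have "d i \<in> set gw" unfolding d_def using p_pos by (intro nth_mem) simp
    then show ?thesis using shortest_word(1) by (auto simp: return_words_def words_def)
  qed
  have "(\<lambda>i. (1 / real b) ^ i) sums (1 / (1 - 1 / real b))"
    using b by (intro geometric_sums) simp
  from sums_mult[OF this, of "(real b - 1) / real b"]
  have gs: "(\<lambda>i. (real b - 1) / real b * (1 / real b) ^ i) sums 1"
    using b by (simp add: field_simps)
  have fle: "f i \<le> (real b - 1) / real b * (1 / real b) ^ i" for i
  proof -
    have "real (d i) \<le> real b - 1" using dl[of i] by linarith
    then have "f i \<le> (real b - 1) / real b ^ Suc i" unfolding f_def by (rule divide_right_mono) simp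
    then show ?thesis by (simp add: power_one_over divide_simps)
  qed
  have f0: "0 \<le> f i" for i by (simp add: f_def)
  have sf: "summable f"
    by (rule summable_comparison_test[OF _ sums_summable[OF gs]]) (use f0 fle in auto)
  show "0 \<le> X" unfolding X by (rule suminf_nonneg[OF sf f0])
  show "X \<le> 1" unfolding X using suminf_le[OF fle sf sums_summable[OF gs]] sums_unique[OF gs] by simp
  have "f (n + p) = f n * (1 / real b ^ p)" for n
    by (simp add: f_def d_def power_add)
  then have "suminf f = suminf f * (1 / real b ^ p) + (\<Sum>i<p. f i)"
    using suminf_split_initial_segment[OF sf, of p] suminf_mult2[OF sf, of "1 / real b ^ p"] by simp
  moreover have "(\<Sum>i<p. f i) = word_real b gw"
  proof -
    have "f i = real (gw ! i * b ^ (p - 1 - i)) / real b ^ p" if "i < p" for i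
    proof -
      have "real b ^ p = real b ^ Suc i * real b ^ (p - 1 - i)"
        unfolding power_add[symmetric] using that by (intro arg_cong[of _ _ "\<lambda>k. real b ^ k"]) simp
      then show ?thesis using that b by (simp add: f_def d_def)
    qed
    then show ?thesis by (simp add: word_real_def word_int_def sum_divide_distrib)
  qed
  ultimately show "X = word_real b gw + X / real b ^ p" by (simp add: X)
qed

lemma offset_shortest [simp]: "offset gw = 0"
  using x_pt_props(3) by (simp add: offset_def)

lemma R_min_pos: "R_min b w > 0"
  by (auto simp: R_min_def max_def)

text \<open>Since \<open>g = h @ gw\<close> and \<open>gw\<close> fixes \<open>x_w\<close>, the word \<open>g\<close> moves \<open>x_w\<close> only as much as the
  shorter word \<open>h\<close> does.\<close>

lemma offset_bound:
  assumes "g \<in> G"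
  shows "\<bar>offset g\<bar> \<le> (1 - real b ^ p / real b ^ length g) * R_min b w"
proof -
  obtain h where h: "h \<in> words b" "g = h @ gw" using return_word_factor[OF assms] .
  define \<beta> where "\<beta> = 1 / real b ^ length h"
  have b0: "b > 0" using b by simp
  have "1 \<le> real b ^ length h" using b by (intro one_le_power) simp
  then have "0 < real b ^ length h" by linarith
  then have \<beta>: "0 \<le> \<beta>" "\<beta> \<le> 1" using \<open>1 \<le> real b ^ length h\<close> by (simp_all add: \<beta>_def)
  have rat: "real b ^ p / real b ^ length g = \<beta>" using b by (simp add: h \<beta>_def power_add)
  have "offset g = word_real b h + \<beta> * (word_real b gw + X / real b ^ p) - X"
    using b by (simp add: offset_def h(2) word_real_append[OF b0] \<beta>_def power_add field_simps)
  \<comment> \<open>The fixed-point equation collapses the contribution of g_w to X, leaving the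
    displacement under h alone. The bounds on \<open>word_real b h\<close> then place it between -
    (1 - \<beta>) X and (1 - \<beta>) (1 - X).\<close>
  then have off: "offset g = word_real b h - (1 - \<beta>) * X"
    using x_pt_props(3) by (simp add: algebra_simps)
  have wr: "0 \<le> word_real b h" "word_real b h \<le> 1 - \<beta>"
    using word_real_bounds[OF h(1) b0] by (auto simp: \<beta>_def)
  have "(1 - \<beta>) * X \<le> (1 - \<beta>) * R_min b w" "(1 - \<beta>) * (1 - X) \<le> (1 - \<beta>) * R_min b w"
    using \<beta> by (auto intro!: mult_left_mono simp: R_min_def)
  then show ?thesis using wr unfolding off rat by (simp add: algebra_simps abs_le_iff)
qed

end

section \<open>The eigenpolynomials\<close>

lemma has_sum_finite_sum:
  fixes f :: "'i \<Rightarrow> 'a \<Rightarrow> 'b::topological_comm_monoid_add"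
  assumes "finite I" "\<And>i. i \<in> I \<Longrightarrow> (f i has_sum s i) A"
  shows "((\<lambda>x. \<Sum>i\<in>I. f i x) has_sum (\<Sum>i\<in>I. s i)) A"
  using assms by (induction I) (auto intro!: has_sum_add)

section \<open>Matrix entries in the scaled coordinate and eigenvalue gaps\<close>

locale pattern_disk = pattern +
  fixes R :: real
  assumes R_gt: "R > R_min b w"
begin

definition contr :: "nat list \<Rightarrow> real" where "contr g = 1 / real b ^ length g"

text \<open>The matrix of the operator with respect to the powers of \<open>(z - x_w) / R\<close>.\<close>

definition K_term :: "nat \<Rightarrow> nat \<Rightarrow> nat list \<Rightarrow> real" where
  "K_term k j g = contr g ^ Suc k * real (j choose k) * (offset g / R) ^ (j - k)"

definition K_mat :: "nat \<Rightarrow> nat \<Rightarrow> real" where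
  "K_mat k j = (\<Sum>\<^sub>\<infinity>g\<in>G. K_term k j g)"

lemma R_pos: "R > 0"
  using R_gt R_min_pos by linarith

lemma contr_bounds: "0 < contr g" "contr g \<le> 1"
  using b by (auto simp: contr_def field_simps)

lemma contr_le: "g \<in> G \<Longrightarrow> contr g \<le> 1 / real b"
  using b power_increasing[of 1 "length g" "real b"]
  by (cases g) (auto simp: contr_def return_words_def intro!: divide_left_mono)

lemma contr_summable: "contr summable_on G"
  using summable_return_words by (simp add: contr_def[abs_def])

text \<open>The product b ^ p \<open>contr g\<close> is the contraction ratio b ^ (- |h|) of the
  word h left after removing g_w from the end of g. It replaces \<open>contr g\<close> once rows are
  normalized.\<close>

lemma ratio_bounds:
  assumes "g \<in> G"
  shows "0 < real b ^ p * contr g" "real b ^ p * contr g \<le> 1" "\<bar>offset g / R\<bar> \<le> 1 - real b ^ p * contr g"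
proof -
  show pos: "0 < real b ^ p * contr g" using b contr_bounds by simp
  have "real b ^ p \<le> real b ^ length g"
    using b shortest_word(2)[OF assms] by (intro power_increasing) auto
  then show le: "real b ^ p * contr g \<le> 1" using b by (simp add: contr_def)
  have "\<bar>offset g\<bar> \<le> (1 - real b ^ p * contr g) * R_min b w"
    using offset_bound[OF assms] by (simp add: contr_def)
  also have "\<dots> \<le> (1 - real b ^ p * contr g) * R"
    using R_gt le by (intro mult_left_mono) auto
  finally show "\<bar>offset g / R\<bar> \<le> 1 - real b ^ p * contr g"
    using R_pos by (simp add: field_simps)
qed

lemma K_term_le:
  assumes "g \<in> G"
  shows "\<bar>K_term k j g\<bar> \<le> real (j choose k) * contr g"
proof -
  have "\<bar>offset g / R\<bar> ^ (j - k) \<le> 1"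
    using ratio_bounds[OF assms] by (intro power_le_one) linarith+
  moreover have "contr g ^ k \<le> 1" using contr_bounds[of g] by (intro power_le_one) auto
  ultimately have "contr g ^ k * \<bar>offset g / R\<bar> ^ (j - k) \<le> 1"
    using contr_bounds[of g] by (intro mult_le_one) auto
  then have "contr g * real (j choose k) * (contr g ^ k * \<bar>offset g / R\<bar> ^ (j - k)) \<le> contr g * real (j choose k) * 1"
    using contr_bounds[of g] by (intro mult_left_mono) auto
  moreover have "\<bar>contr g\<bar> = contr g" using contr_bounds[of g] by simp
  ultimately show ?thesis by (simp add: K_term_def abs_mult power_abs mult_ac)
qed

lemma K_term_abs_summable: "(\<lambda>g. \<bar>K_term k j g\<bar>) summable_on G"
  using summable_on_cmult_right[OF contr_summable, of "real (j choose k)"]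
  by (rule summable_on_comparison_test) (auto intro: K_term_le)

lemma K_term_summable: "K_term k j summable_on G"
  by (rule abs_summable_summable) (simp add: K_term_abs_summable)

lemma K_term_has_sum: "(K_term k j has_sum K_mat k j) G"
  unfolding K_mat_def using K_term_summable by simp

lemma K_mat_lower: "j < k \<Longrightarrow> K_mat k j = 0"
  by (simp add: K_mat_def K_term_def binomial_eq_0)

lemma K_mat_diag: "K_mat k k = eigval b w (k + 1)"
  unfolding K_mat_def eigval_def
  by (intro infsum_cong) (simp add: K_term_def contr_def power_mult[symmetric] power_one_over mult.commute power_add)

text \<open>Diagonal entries are power sums of the ratios \<open>contr g\<close>, all at most 1/2
  because b >= 2. Raising the exponent therefore at least halves the sum, so the gap is at least
  half of the entry in row k, which in turn is at least the single term of g_w. Both the factor 2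
  and the power reappear in \<open>col_weight\<close>.\<close>

lemma K_mat_diag_gap:
  assumes "k < m"
  shows "(1 / real b ^ p) ^ Suc k \<le> 2 * (K_mat k k - K_mat m m)"
proof -
  have t: "K_term k k g = contr g ^ Suc k" for k g by (simp add: K_term_def)
  have "(\<Sum>g\<in>{gw}. K_term k k g) \<le> K_mat k k"
    unfolding K_mat_def using shortest_word(1) less_imp_le[OF contr_bounds(1)]
    by (intro finite_sum_le_infsum K_term_summable) (auto simp: t)
  then have 1: "(1 / real b ^ p) ^ Suc k \<le> K_mat k k" by (simp only: t) (simp add: contr_def)
  have "K_mat m m \<le> (\<Sum>\<^sub>\<infinity>g\<in>G. 1 / 2 * K_term k k g)"
    unfolding K_mat_def
  proof (rule infsum_mono)
    fix g assume g: "g \<in> G"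
    have "1 / real b \<le> 1 / 2" using b by (intro divide_left_mono) auto
    then have "contr g \<le> 1 / 2" using contr_le[OF g] by linarith
    have "contr g ^ Suc m \<le> contr g ^ Suc (Suc k)"
      using assms contr_bounds[of g] by (intro power_decreasing) auto
    also have "\<dots> \<le> 1 / 2 * contr g ^ Suc k"
      using \<open>contr g \<le> 1 / 2\<close> contr_bounds[of g] by (subst power_Suc) (intro mult_right_mono, auto)
    finally show "K_term m m g \<le> 1 / 2 * K_term k k g" by (simp only: t)
  qed (intro summable_on_cmult_right K_term_summable)+
  also have "\<dots> = 1 / 2 * K_mat k k"
    unfolding K_mat_def using K_term_summable by (intro infsum_cmult_right) auto
  finally have "K_mat k k \<le> 2 * (K_mat k k - K_mat m m)" by simp
  with 1 show ?thesis by (rule order_trans)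
qed

section \<open>Exponential decay of the normalized columns\<close>

definition col_weight :: "nat \<Rightarrow> nat \<Rightarrow> real" where
  "col_weight k j = 2 * \<bar>K_mat k j\<bar> / (1 / real b ^ p) ^ Suc k"

text \<open>With \<rho> = \<open>R_min b w / R\<close>, this is \<rho> + (1 - \<rho>) \<eta> at
  \<eta> = 1 / b, the largest ratio possible for a non-empty h.\<close>

definition rate :: real where
  "rate = R_min b w / R + (1 - R_min b w / R) / real b"

lemma rate_bounds: "0 \<le> rate" "rate < 1"
proof -
  define \<rho> where "\<rho> = R_min b w / R"
  have \<rho>: "0 \<le> \<rho>" "\<rho> < 1" using R_pos R_gt R_min_pos by (auto simp: \<rho>_def)
  have "(1 - \<rho>) / real b < 1 - \<rho>" using \<rho> b by (simp add: divide_less_eq)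
  moreover have "0 \<le> (1 - \<rho>) / real b" using \<rho> by simp
  ultimately show "0 \<le> rate" "rate < 1" using \<rho> unfolding rate_def \<rho>_def[symmetric] by linarith+
qed

text \<open>The left side is the relative radius of a disk about x_w containing the image of the
  radius R disk under h. Since h is non-empty, its ratio \<eta> is at most 1 / b, and
  \<open>offset_bound\<close> bounds the sum by an increasing function of \<eta>.\<close>

lemma rate_ge:
  assumes "g \<in> G" "g \<noteq> gw"
  shows "real b ^ p * contr g + \<bar>offset g / R\<bar> \<le> rate"
proof -
  define \<rho> where "\<rho> = R_min b w / R"
  define \<eta> where "\<eta> = real b ^ p * contr g"
  have \<rho>: "0 \<le> \<rho>" "\<rho> < 1" using R_pos R_gt R_min_pos by (auto simp: \<rho>_def)
  have "real b ^ Suc p \<le> real b ^ length g"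
    using b return_word_longer[OF assms] by (intro power_increasing) auto
  then have \<eta>: "\<eta> \<le> 1 / real b" using b by (simp add: \<eta>_def contr_def field_simps)
  have "\<bar>offset g / R\<bar> \<le> (1 - \<eta>) * \<rho>"
    using offset_bound[OF assms(1)] R_pos
    by (simp add: \<eta>_def \<rho>_def contr_def abs_divide divide_right_mono)
  then have "\<eta> + \<bar>offset g / R\<bar> \<le> \<rho> + (1 - \<rho>) * \<eta>" by (simp add: algebra_simps)
  also have "\<dots> \<le> \<rho> + (1 - \<rho>) * (1 / real b)"
    using \<eta> \<rho> by (intro add_left_mono mult_left_mono) auto
  finally show ?thesis by (simp add: rate_def \<eta>_def \<rho>_def)
qed

text \<open>Adding the term k = j completes the binomial expansion of (\<eta> + y) ^ j, controlled
  by \<open>rate_ge\<close>. The word g_w has \<eta> = 1 and escapes that bound, but its zero offset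
  makes all its terms with k < j vanish.\<close>

lemma scaled_term_sum:
  assumes g: "g \<in> G"
  shows "(\<Sum>k<j. \<bar>K_term k j g\<bar> * (real b ^ p) ^ Suc k) \<le> real b ^ p * rate ^ j * contr g"
proof (cases "g = gw")
  case True
  have "K_term k j gw = 0" if "k < j" for k using that by (simp add: K_term_def)
  then show ?thesis using True contr_bounds[of gw] rate_bounds by simp
next
  case False
  define \<eta> where "\<eta> = real b ^ p * contr g"
  define y where "y = \<bar>offset g / R\<bar>"
  have \<eta>: "0 < \<eta>" unfolding \<eta>_def by (rule ratio_bounds[OF g])
  have y: "0 \<le> y" by (simp add: y_def)
  have scaled: "\<bar>K_term k j g\<bar> * (real b ^ p) ^ Suc k = \<eta> * (real (j choose k) * \<eta> ^ k * y ^ (j - k))" for k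
    using contr_bounds[of g] unfolding K_term_def abs_mult power_abs y_def[symmetric] \<eta>_def power_mult_distrib
    by simp
  have "(\<Sum>k<j. \<bar>K_term k j g\<bar> * (real b ^ p) ^ Suc k) \<le> (\<Sum>k\<le>j. \<bar>K_term k j g\<bar> * (real b ^ p) ^ Suc k)"
    by (intro sum_mono2) auto
  also have "\<dots> = \<eta> * (\<eta> + y) ^ j"
    by (simp only: scaled sum_distrib_left[symmetric] binomial_ring)
  also have "\<dots> \<le> \<eta> * rate ^ j"
    using \<eta> y rate_ge[OF g False] by (intro mult_left_mono power_mono) (auto simp: \<eta>_def y_def)
  finally show ?thesis by (simp add: \<eta>_def mult_ac)
qed

text \<open>The finite sum over rows is exchanged with the sum over return words, where
  \<open>scaled_term_sum\<close> applies to each word; the remaining total of \<open>contr g\<close>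
  is at most 1 by Kraft's inequality.\<close>

lemma col_weight_sum: "(\<Sum>k<j. col_weight k j) \<le> 2 * real b ^ p * rate ^ j"
proof -
  have hs: "((\<lambda>g. \<bar>K_term k j g\<bar> * (real b ^ p) ^ Suc k) has_sum
      (\<Sum>\<^sub>\<infinity>g\<in>G. \<bar>K_term k j g\<bar>) * (real b ^ p) ^ Suc k) G" for k
    by (intro has_sum_cmult_left has_sum_infsum K_term_abs_summable)
  have "\<bar>K_mat k j\<bar> \<le> (\<Sum>\<^sub>\<infinity>g\<in>G. \<bar>K_term k j g\<bar>)" for k
    unfolding K_mat_def real_norm_def[symmetric] using K_term_abs_summable
    by (intro norm_infsum_bound) auto
  then have "\<bar>K_mat k j\<bar> * (real b ^ p) ^ Suc k \<le> (\<Sum>\<^sub>\<infinity>g\<in>G. \<bar>K_term k j g\<bar>) * (real b ^ p) ^ Suc k" for k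
    by (intro mult_right_mono) auto
  then have "(\<Sum>k<j. \<bar>K_mat k j\<bar> * (real b ^ p) ^ Suc k) \<le>
      (\<Sum>k<j. (\<Sum>\<^sub>\<infinity>g\<in>G. \<bar>K_term k j g\<bar>) * (real b ^ p) ^ Suc k)" by (rule sum_mono)
  also have "\<dots> \<le> real b ^ p * rate ^ j * (\<Sum>\<^sub>\<infinity>g\<in>G. contr g)"
  proof (rule has_sum_mono)
    show "((\<lambda>g. \<Sum>k<j. \<bar>K_term k j g\<bar> * (real b ^ p) ^ Suc k) has_sum
        (\<Sum>k<j. (\<Sum>\<^sub>\<infinity>g\<in>G. \<bar>K_term k j g\<bar>) * (real b ^ p) ^ Suc k)) G"
      by (rule has_sum_finite_sum[OF _ hs]) auto
    show "((\<lambda>g. real b ^ p * rate ^ j * contr g) has_sum real b ^ p * rate ^ j * (\<Sum>\<^sub>\<infinity>g\<in>G. contr g)) G"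
      by (intro has_sum_cmult_right has_sum_infsum contr_summable)
  qed (rule scaled_term_sum)
  also have "\<dots> \<le> real b ^ p * rate ^ j * 1"
    using kraft rate_bounds by (intro mult_left_mono) (auto simp: contr_def)
  finally have "(\<Sum>k<j. \<bar>K_mat k j\<bar> * (real b ^ p) ^ Suc k) \<le> real b ^ p * rate ^ j" by simp
  moreover have "col_weight k j = 2 * (\<bar>K_mat k j\<bar> * (real b ^ p) ^ Suc k)" for k
    by (simp add: col_weight_def power_divide)
  ultimately show ?thesis by (simp add: sum_distrib_left[symmetric])
qed

section \<open>Eigenvectors of the triangular matrix\<close>

definition back_coeff :: "nat \<Rightarrow> nat \<Rightarrow> nat \<Rightarrow> complex" where
  "back_coeff m k j = of_real (- (K_mat k j / (K_mat k k - K_mat m m)))"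

text \<open>The eigenvector for \<open>K_mat m m\<close> with top coordinate 1;
  \<open>back_coeff\<close> arises by solving row k of the eigenvector equation for the entry q
  k.\<close>

definition evec :: "nat \<Rightarrow> nat \<Rightarrow> complex" where
  "evec m = (SOME q. q m = 1 \<and> (\<forall>k>m. q k = 0) \<and>
     (\<forall>k<m. q k = (\<Sum>j\<in>{k<..m}. back_coeff m k j * q j)))"

lemma evec: "evec m m = 1" "m < k \<Longrightarrow> evec m k = 0"
  "k < m \<Longrightarrow> evec m k = (\<Sum>j\<in>{k<..m}. back_coeff m k j * evec m j)"
  using someI_ex[OF back_substitution_exists[of m "back_coeff m"]] unfolding evec_def by blast+

text \<open>The coefficients change with m through the shifted eigenvalue, but the gap estimate
  majorizes them by \<open>col_weight\<close>, which does not depend on m. One Gronwall constant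
  thus serves all m.\<close>

lemma evec_bound:
  obtains M where "0 \<le> M" "\<And>m. (\<Sum>k<m. cmod (evec m k)) \<le> M * rate ^ m"
proof -
  have A0: "0 \<le> col_weight k j" for k j by (simp add: col_weight_def)
  have C0: "0 \<le> 2 * real b ^ p" by simp
  obtain M where M: "M \<ge> 0" "\<forall>m (q :: nat \<Rightarrow> real). q m = 1 \<longrightarrow> (\<forall>k. q k \<ge> 0) \<longrightarrow>
       (\<forall>k<m. q k \<le> (\<Sum>j\<in>{k<..m}. col_weight k j * q j)) \<longrightarrow> (\<Sum>k<m. q k) \<le> M * rate ^ m"
    using back_substitution_bound[OF C0 rate_bounds A0 col_weight_sum] by blast
  have bc: "cmod (back_coeff m k j) \<le> col_weight k j" if "k < m" for m k j
  proof -
    have d: "0 < (1 / real b ^ p) ^ Suc k" using b by simp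
    have gap: "(1 / real b ^ p) ^ Suc k / 2 \<le> K_mat k k - K_mat m m" using K_mat_diag_gap[OF that] by simp
    then have "\<bar>K_mat k j\<bar> / (K_mat k k - K_mat m m) \<le> \<bar>K_mat k j\<bar> / ((1 / real b ^ p) ^ Suc k / 2)"
      using d by (intro divide_left_mono mult_pos_pos) linarith+
    moreover have "cmod (back_coeff m k j) = \<bar>K_mat k j\<bar> / (K_mat k k - K_mat m m)"
      using gap d unfolding back_coeff_def norm_of_real by simp
    ultimately show ?thesis by (simp add: col_weight_def mult_ac)
  qed
  have "(\<Sum>k<m. cmod (evec m k)) \<le> M * rate ^ m" for m
  proof (rule M(2)[rule_format])
    fix k assume k: "k < m"
    show "cmod (evec m k) \<le> (\<Sum>j\<in>{k<..m}. col_weight k j * cmod (evec m j))"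
      unfolding evec(3)[OF k]
      by (intro sum_norm_le) (auto simp: norm_mult intro!: mult_right_mono bc[OF k])
  qed (simp_all add: evec(1))
  with M(1) that show ?thesis by blast
qed

section \<open>From polynomials to coefficient vectors\<close>

lemma K_op_expansion:
  fixes q :: "nat \<Rightarrow> complex"
  shows "K_op b w (\<lambda>z. \<Sum>j\<le>m. q j * ((z - of_real X) / of_real R) ^ j) (of_real X + of_real R * \<zeta>) =
    (\<Sum>k\<le>m. (\<Sum>j\<le>m. of_real (K_mat k j) * q j) * \<zeta> ^ k)"
  unfolding K_op_def
proof (rule infsumI)
  have R: "complex_of_real R \<noteq> 0" using R_pos by simp
  have "((\<lambda>g. \<Sum>k\<le>m. (\<Sum>j\<le>m. of_real (K_term k j g) * q j) * \<zeta> ^ k) has_sum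
      (\<Sum>k\<le>m. (\<Sum>j\<le>m. of_real (K_mat k j) * q j) * \<zeta> ^ k)) G"
    by (intro has_sum_finite_sum has_sum_cmult_left has_sum_of_real K_term_has_sum) auto
  moreover have "1 / of_nat b ^ length g *
      (\<Sum>j\<le>m. q j * ((of_real (word_real b g) + (of_real X + of_real R * \<zeta>) / of_nat b ^ length g
         - of_real X) / of_real R) ^ j) =
      (\<Sum>k\<le>m. (\<Sum>j\<le>m. of_real (K_term k j g) * q j) * \<zeta> ^ k)" for g
  proof -
    have c: "complex_of_real (contr g) = 1 / of_nat b ^ length g" by (simp add: contr_def)
    \<comment> \<open>In the coordinate \<zeta> the map of g becomes affine with slope
      \<open>contr g\<close> and constant term \<open>offset g / R\<close>, which produces the
      entries \<open>K_term k j g\<close> by binomial expansion.\<close>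
    have pt: "(of_real (word_real b g) + (of_real X + of_real R * \<zeta>) / of_nat b ^ length g
         - of_real X) / of_real R = of_real (contr g) * \<zeta> + of_real (offset g / R)"
      using R b unfolding c by (simp add: offset_def field_simps)
    \<comment> \<open>The range is extended from j to m by vanishing binomial coefficients, so that
      all j share one index set and the two sums can be swapped.\<close>
    have "(of_real (contr g) * \<zeta> + of_real (offset g / R)) ^ j =
        (\<Sum>k\<le>m. of_nat (j choose k) * (of_real (contr g) * \<zeta>) ^ k * of_real (offset g / R) ^ (j - k))"
      if "j \<le> m" for j
      unfolding binomial_ring by (intro sum.mono_neutral_left) (use that in auto)
    then have "of_real (contr g) * (q j * (of_real (contr g) * \<zeta> + of_real (offset g / R)) ^ j) =
        (\<Sum>k\<le>m. of_real (K_term k j g) * q j * \<zeta> ^ k)" if "j \<le> m" for j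
      using that by (simp add: sum_distrib_left K_term_def power_mult_distrib mult_ac)
    then have "of_real (contr g) * (\<Sum>j\<le>m. q j * (of_real (contr g) * \<zeta> + of_real (offset g / R)) ^ j) =
        (\<Sum>j\<le>m. \<Sum>k\<le>m. of_real (K_term k j g) * q j * \<zeta> ^ k)"
      unfolding sum_distrib_left by (intro sum.cong) auto
    also have "\<dots> = (\<Sum>k\<le>m. (\<Sum>j\<le>m. of_real (K_term k j g) * q j) * \<zeta> ^ k)"
      by (subst sum.swap) (simp add: sum_distrib_right)
    finally show ?thesis unfolding pt c .
  qed
  ultimately show "((\<lambda>g. 1 / of_nat b ^ length g *
      (\<Sum>j\<le>m. q j * ((of_real (word_real b g) + (of_real X + of_real R * \<zeta>) / of_nat b ^ length g
         - of_real X) / of_real R) ^ j)) has_sum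
      (\<Sum>k\<le>m. (\<Sum>j\<le>m. of_real (K_mat k j) * q j) * \<zeta> ^ k)) G"
    by simp
qed

text \<open>Comparing coefficients in \<zeta> gives one equation per row. Row m holds automatically
  by triangularity; every other row can be solved for q k because the diagonal gap is
  non-zero.\<close>

lemma eigenfunction_iff:
  fixes q :: "nat \<Rightarrow> complex" and m :: nat
  defines "f \<equiv> \<lambda>z. \<Sum>j\<le>m. q j * ((z - of_real X) / of_real R) ^ j"
  shows "(\<forall>x. K_op b w f x = of_real (eigval b w (m + 1)) * f x) \<longleftrightarrow>
    (\<forall>k<m. q k = (\<Sum>j\<in>{k<..m}. back_coeff m k j * q j))"
proof -
  have R: "complex_of_real R \<noteq> 0" using R_pos by simp
  have coord: "\<exists>\<zeta> :: complex. x = of_real X + of_real R * \<zeta>" for x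
    by (rule exI[of _ "(x - of_real X) / of_real R"]) (use R in simp)
  have f: "f (of_real X + of_real R * \<zeta>) = (\<Sum>k\<le>m. q k * \<zeta> ^ k)" for \<zeta>
    using R by (simp add: f_def)
  have "(\<forall>x. K_op b w f x = of_real (eigval b w (m + 1)) * f x) \<longleftrightarrow>
      (\<forall>\<zeta>. K_op b w f (of_real X + of_real R * \<zeta>) =
        of_real (eigval b w (m + 1)) * f (of_real X + of_real R * \<zeta>))"
    using coord by metis
  also have "\<dots> \<longleftrightarrow> (\<forall>\<zeta>. (\<Sum>k\<le>m. (\<Sum>j\<le>m. of_real (K_mat k j) * q j) * \<zeta> ^ k) =
      (\<Sum>k\<le>m. (of_real (K_mat m m) * q k) * \<zeta> ^ k))"
    unfolding f unfolding f_def K_op_expansion K_mat_diag by (simp add: sum_distrib_left mult.assoc)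
  also have "\<dots> \<longleftrightarrow> (\<forall>k\<le>m. (\<Sum>j\<le>m. of_real (K_mat k j) * q j) = of_real (K_mat m m) * q k)"
    by (rule polyfun_eq_coeffs)
  also have "\<dots> \<longleftrightarrow> (\<forall>k<m. (\<Sum>j\<le>m. of_real (K_mat k j) * q j) = of_real (K_mat m m) * q k)"
  proof -
    have "(\<Sum>j\<le>m. of_real (K_mat m j) * q j) = (\<Sum>j\<in>{m}. of_real (K_mat m j) * q j)"
      by (intro sum.mono_neutral_right) (auto simp: K_mat_lower)
    then show ?thesis by (auto simp: le_less)
  qed
  also have "\<dots> \<longleftrightarrow> (\<forall>k<m. q k = (\<Sum>j\<in>{k<..m}. back_coeff m k j * q j))"
  proof (intro all_cong)
    fix k assume k: "k < m"
    define S where "S = (\<Sum>j\<in>{k<..m}. of_real (K_mat k j) * q j)"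
    define D where "D = K_mat k k - K_mat m m"
    have "0 < (1 / real b ^ p) ^ Suc k" using b by simp
    then have D: "D \<noteq> 0" using K_mat_diag_gap[OF k] by (simp add: D_def)
    have "{..m} = {..<k} \<union> insert k {k<..m}" using k by auto
    then have "(\<Sum>j\<le>m. of_real (K_mat k j) * q j) =
        (\<Sum>j<k. of_real (K_mat k j) * q j) + (\<Sum>j\<in>insert k {k<..m}. of_real (K_mat k j) * q j)"
      by (simp only:) (intro sum.union_disjoint; auto)
    also have "\<dots> = of_real (K_mat k k) * q k + S" by (simp add: K_mat_lower S_def)
    finally have "(\<Sum>j\<le>m. of_real (K_mat k j) * q j) = of_real (K_mat m m) * q k \<longleftrightarrow> of_real D * q k = - S"
      by (simp add: D_def algebra_simps add_eq_0_iff)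
    also have "\<dots> \<longleftrightarrow> q k = - S / of_real D" using D by (simp add: field_simps)
    also have "- S / of_real D = (\<Sum>j\<in>{k<..m}. back_coeff m k j * q j)"
      by (simp add: S_def D_def back_coeff_def sum_divide_distrib sum_negf)
    finally show "(\<Sum>j\<le>m. of_real (K_mat k j) * q j) = of_real (K_mat m m) * q k \<longleftrightarrow>
        q k = (\<Sum>j\<in>{k<..m}. back_coeff m k j * q j)" .
  qed
  finally show ?thesis .
qed

text \<open>The system is homogeneous and linear, and descending through the rows fixes every entry
  in terms of q m.\<close>

lemma back_solution_unique:
  assumes q: "\<forall>k<m. q k = (\<Sum>j\<in>{k<..m}. back_coeff m k j * q j)" and k: "k \<le> m"
  shows "q k = q m * evec m k"
  using k
proof (induction "m - k" arbitrary: k rule: less_induct)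
  case less
  show ?case
  proof (cases "k = m")
    case False
    then have km: "k < m" using less.prems by simp
    have "q k = (\<Sum>j\<in>{k<..m}. back_coeff m k j * q j)" using q km by blast
    also have "\<dots> = (\<Sum>j\<in>{k<..m}. back_coeff m k j * (q m * evec m j))"
    proof (rule sum.cong)
      fix j assume "j \<in> {k<..m}"
      then have "q j = q m * evec m j" using km by (intro less.hyps) auto
      then show "back_coeff m k j * q j = back_coeff m k j * (q m * evec m j)" by simp
    qed simp
    also have "\<dots> = q m * evec m k"
      unfolding evec(3)[OF km] sum_distrib_left by (intro sum.cong) (auto simp: mult_ac)
    finally show ?thesis .
  qed (simp add: evec(1))
qed

text \<open>Unfolding the definite description requires existence and uniqueness. The candidate P
  carries a factor R ^ m that restores a leading coefficient 1 after the substitution \<zeta> = (z -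
  x_w) / R, and the normalization in the statement removes it again.\<close>

lemma poly_eigpoly:
  "poly (eigpoly b w m) z / of_real R ^ m = (\<Sum>k\<le>m. evec m k * ((z - of_real X) / of_real R) ^ k)"
proof -
  define L where "L = [:- of_real X / of_real R, 1 / of_real R :: complex:]"
  define L' where "L' = [:of_real X, of_real R :: complex:]"
  have R: "complex_of_real R \<noteq> 0" using R_pos by simp
  have L: "poly L z = (z - of_real X) / of_real R" for z using R by (simp add: L_def field_simps)
  have L': "poly L' (poly L z) = z" for z using R unfolding L by (simp add: L'_def)
  have dL: "degree L = 1" "lead_coeff L = 1 / of_real R" using R by (auto simp: L_def)
  have dL': "degree L' = 1" "lead_coeff L' = of_real R" using R by (auto simp: L'_def)
  define Q where "Q = (\<Sum>k\<le>m. monom (evec m k) k)"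
  have cQ: "coeff Q k = evec m k" for k
  proof -
    have "coeff Q k = (\<Sum>j\<le>m. if j = k then evec m j else 0)"
      by (simp add: Q_def coeff_sum)
    then show ?thesis by (simp add: evec(2) not_le)
  qed
  have dQ: "degree Q = m"
    by (rule antisym[OF degree_le le_degree]) (auto simp: cQ evec(1,2))
  define P where "P = smult (of_real R ^ m) (pcompose Q L)"
  have "degree P = m" using R by (simp add: P_def degree_pcompose dL dQ)
  moreover have "lead_coeff P = 1"
  proof -
    have "lead_coeff (pcompose Q L) = (1 / of_real R) ^ m"
      using lead_coeff_comp[of L Q] unfolding dL(2) dQ cQ evec(1) by (simp only: dL(1)) simp
    then show ?thesis using R by (simp only: P_def lead_coeff_smult) (simp add: power_divide)
  qed
  moreover have Pz: "poly P z = (\<Sum>k\<le>m. (of_real R ^ m * evec m k) * ((z - of_real X) / of_real R) ^ k)" for z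
    by (simp add: P_def poly_pcompose L poly_altdef[of Q] dQ cQ sum_distrib_left mult.assoc)
  moreover have "\<forall>x. K_op b w (poly P) x = of_real (eigval b w (m + 1)) * poly P x"
    unfolding Pz[abs_def] eigenfunction_iff
    by (auto simp: evec(3) sum_distrib_left mult_ac intro!: sum.cong)
  moreover have "P' = P" if P': "degree P' = m" "lead_coeff P' = 1"
      "\<forall>x. K_op b w (poly P') x = of_real (eigval b w (m + 1)) * poly P' x" for P'
  proof -
    \<comment> \<open>A competing P' is rewritten in powers of \<zeta> by the inverse substitution
      \<open>L'\<close>. Being monic it has q m = R ^ m, so uniqueness of back substitution
      identifies it with P.\<close>
    define q where "q k = coeff (pcompose P' L') k" for k
    have dq: "degree (pcompose P' L') = m" by (simp add: degree_pcompose dL' P')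
    have cm: "coeff P' m = 1" using P'(1,2) by simp
    have qm: "q m = of_real R ^ m"
      using lead_coeff_comp[of L' P'] unfolding dL'(2) P'(1) dq q_def cm by (simp only: dL'(1)) simp
    have "poly P' z = (\<Sum>k\<le>m. q k * ((z - of_real X) / of_real R) ^ k)" for z
    proof -
      have "poly P' z = poly (pcompose P' L') (poly L z)" by (simp only: poly_pcompose L')
      then show ?thesis unfolding poly_altdef[of "pcompose P' L'"] dq by (simp add: q_def L)
    qed
    then have P'z: "poly P' = (\<lambda>z. \<Sum>k\<le>m. q k * ((z - of_real X) / of_real R) ^ k)" by blast
    have "q k = of_real R ^ m * evec m k" if "k \<le> m" for k
      using back_solution_unique[OF _ that] P'(3) unfolding P'z eigenfunction_iff qm[symmetric] by blast
    then have "poly P' = poly P" unfolding P'z by (auto simp: Pz intro!: sum.cong)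
    then show "P' = P" by (simp add: poly_eq_poly_eq_iff)
  qed
  ultimately have "eigpoly b w m = P" unfolding eigpoly_def by (intro the_equality) blast+
  then show ?thesis using R by (simp add: Pz sum_divide_distrib)
qed

section \<open>Comparison with the monomials\<close>

definition N_mat :: "nat \<Rightarrow> nat \<Rightarrow> complex" where
  "N_mat k m = (if k < m then evec m k else 0)"

lemma N_mat_bound:
  obtains M where "0 \<le> M" "\<And>m. (\<Sum>k<m. cmod (N_mat k m)) \<le> M * rate ^ m"
proof -
  obtain M where "0 \<le> M" "\<And>m. (\<Sum>k<m. cmod (evec m k)) \<le> M * rate ^ m"
    using evec_bound by blast
  then show ?thesis using that[of M] by (simp add: N_mat_def)
qed

lemma N_mat_tri: "strict_tri N_mat"
proof -
  obtain M where "0 \<le> M" "\<And>m. (\<Sum>k<m. cmod (N_mat k m)) \<le> M * rate ^ m"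
    using N_mat_bound by blast
  then show ?thesis unfolding strict_tri_def using rate_bounds
    by (intro conjI exI[of _ M] exI[of _ rate]) (auto simp: N_mat_def)
qed

lemma hardy_eigpoly_eq:
  "hardy_eigpoly b w R m = synth (of_real X) R (\<lambda>k. unit_seq m k + N_mat k m)"
proof -
  have "evec m k = unit_seq m k + N_mat k m" for k
    by (cases k m rule: linorder_cases) (auto simp: unit_seq_def N_mat_def evec(1,2))
  then show ?thesis
    by (subst synth_finite_support[of "{..m}"])
      (auto simp: hardy_eigpoly_def poly_eigpoly unit_seq_def N_mat_def)
qed

text \<open>The difference has column m of \<open>N_mat\<close> as its coefficients; by the isometry
  its norm is an l2 norm, which the l1 norm dominates.\<close>

lemma eigpoly_close:
  "ip_norm (hardy_inner (of_real X) R) (\<lambda>z. hardy_eigpoly b w R m z - hardy_monom (of_real X) R m z)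
     \<le> (\<Sum>k<m. cmod (N_mat k m))"
proof -
  have fin: "finite {k. N_mat k m \<noteq> 0}" "finite {k. unit_seq m k + N_mat k m \<noteq> 0}"
    by (rule finite_subset[of _ "{..m}"]; auto simp: N_mat_def unit_seq_def split: if_splits)+
  have l2: "(\<lambda>k. unit_seq m k + N_mat k m) \<in> l2" by (rule l2_finite_support[OF fin(2)])
  have "(\<lambda>k. cmod (N_mat k m)) sums (\<Sum>k<m. cmod (N_mat k m))"
    by (rule sums_finite) (auto simp: N_mat_def)
  then have s: "summable (\<lambda>k. cmod (N_mat k m))" "(\<Sum>k. cmod (N_mat k m)) = (\<Sum>k<m. cmod (N_mat k m))"
    by (auto simp: sums_iff)
  have "(\<lambda>z. hardy_eigpoly b w R m z - hardy_monom (of_real X) R m z) = synth (of_real X) R (\<lambda>k. N_mat k m)"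
    using synth_lin[OF R_pos l2 unit_seq_l2[of m], of "of_real X" 1 "-1"]
    by (simp add: hardy_eigpoly_eq hardy_monom_eq)
  then show ?thesis
    using ip_norm_synth[OF R_pos, of "\<lambda>k. N_mat k m" "of_real X"] l2_of_abs_summable[OF s(1), of "\<lambda>k. N_mat k m"] s(2)
    by simp
qed

end

theorem proposition10:
  fixes b :: nat and w :: "nat list" and R :: real and c :: complex
  assumes "b > 1" and "w \<in> words b" and "w \<noteq> []" and "R > R_min b w"
    and "c = of_real (x_pt b w)"
  shows "orthonormal_basis (hardy_space c R) (hardy_inner c R) (hardy_monom c R) \<and>
    (\<exists>C \<theta>. 0 \<le> \<theta> \<and> \<theta> < 1 \<and>
       (\<forall>m. ip_norm (hardy_inner c R)
              (\<lambda>z. hardy_eigpoly b w R m z - hardy_monom c R m z) \<le> C * \<theta> ^ m)) \<and>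
    riesz_basis (hardy_space c R) (hardy_inner c R) (hardy_eigpoly b w R)"
proof -
  interpret pattern_disk b w R
    by unfold_locales (use assms in auto)
  obtain M where M: "\<And>m. (\<Sum>k<m. cmod (N_mat k m)) \<le> M * rate ^ m"
    using N_mat_bound by blast
  have "ip_norm (hardy_inner c R) (\<lambda>z. hardy_eigpoly b w R m z - hardy_monom c R m z) \<le> M * rate ^ m" for m
    unfolding assms(5) using eigpoly_close M by (rule order_trans)
  moreover have "riesz_basis (hardy_space c R) (hardy_inner c R) (hardy_eigpoly b w R)"
    unfolding assms(5) by (rule riesz_basis_of_strict_tri[OF R_pos N_mat_tri hardy_eigpoly_eq])
  ultimately show ?thesis
    using hardy_monom_orthonormal[OF R_pos] rate_bounds by blast
qed

end
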